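(* Let $d\ge 2$ and let $f,g:[-1,1]\to\mathbb{R}$ be continuous functions which are the isotropic parts of positive definite kernels on the unit sphere $S^d$, with Fourier--Jacobi series representations $$f(t)=\sum_{k=0}^\infty a_k(f)P_k^{((d-2)/2,(d-2)/2)}(t),\qquad g(t)=\sum_{k=0}^\infty a_k(g)P_k^{((d-2)/2,(d-2)/2)}(t),\qquad t\in[-1,1],$$ where all coefficients are nonnegative and both series converge at $t=1$. Then the product $fg$ is the isotropic part of a strictly positive definite kernel on $S^d$ if, and only if, the set $$\{k+l:\ k,l\in\mathbb{Z}_+,\ a_k(f)a_l(g)>0\}$$ contains infinitely many even and infinitely many odd integers.
   Context: $S^d$ is the unit sphere in $\mathbb{R}^{d+1}$. Its geodesic distance is normalized so that the largest distance $|xy|$ equals $2\pi$; thus $\cos(|xy|/2)=x\cdot y$, the usual inner product. A continuous function $f:[-1,1]\to\mathbb{R}$ is called the isotropic part of the kernel $K(x,y)=f(\cos(|xy|/2))$, $x,y\in S^d$. The kernel $K$ is positive definite if $\sum_{i,j=1}^n c_ic_jK(x_i,x_j)\ge 0$ for all $n\geq 1$, all distinct points $x_1,\dots,x_n\in S^d$ and all real $c_1,\dots,c_n$; it is strictly positive definite if in addition the inequality is strict whenever $c_1,\dots,c_n$ are not all zero. By Schoenberg's theorem, a continuous $f$ is the isotropic part of a positive definite kernel on $S^d$ if and only if it has a (unique) representation $f(t)=\sum_{k\ge0}a_k(f)P_k^{((d-2)/2,(d-2)/2)}(t)$ with all $a_k(f)\ge 0$ and the series convergent at $t=1$. Here $P_k^{(\alpha,\beta)}$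 is the usual Jacobi polynomial of degree $k$; $P_k^{((d-2)/2,(d-2)/2)}$ is a positive multiple of the Gegenbauer polynomial $C_k^{(d-1)/2}$. $\mathbb{Z}_+$ is the set of nonnegative integers. *)

theory Defs
  imports "HOL-Analysis.Analysis"
begin

definition pos_def_kernel_on :: "'a set \<Rightarrow> ('a \<Rightarrow> 'a \<Rightarrow> real) \<Rightarrow> bool" where
  "pos_def_kernel_on X K \<longleftrightarrow>
     (\<forall>n\<ge>1. \<forall>(x :: nat \<Rightarrow> 'a) (c :: nat \<Rightarrow> real).
        (\<forall>i<n. x i \<in> X) \<and> inj_on x {..<n} \<longrightarrow>
        (\<Sum>i<n. \<Sum>j<n. c i * c j * K (x i) (x j)) \<ge> 0)"

definition strictly_pos_def_kernel_on :: "'a set \<Rightarrow> ('a \<Rightarrow> 'a \<Rightarrow> real) \<Rightarrow> bool" where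
  "strictly_pos_def_kernel_on X K \<longleftrightarrow>
     pos_def_kernel_on X K \<and>
     (\<forall>n\<ge>1. \<forall>(x :: nat \<Rightarrow> 'a) (c :: nat \<Rightarrow> real).
        (\<forall>i<n. x i \<in> X) \<and> inj_on x {..<n} \<and> (\<exists>i<n. c i \<noteq> 0) \<longrightarrow>
        (\<Sum>i<n. \<Sum>j<n. c i * c j * K (x i) (x j)) > 0)"

text \<open>The geodesic distance on the unit sphere is the angle \<open>arccos (x \<bullet> y)\<close>; the factor 2
  normalizes it so that antipodal points have distance \<open>2 * pi\<close>.\<close>

definition geodesic_dist :: "'a::real_inner \<Rightarrow> 'a \<Rightarrow> real" where
  "geodesic_dist x y = 2 * arccos (x \<bullet> y)"

definition isotropic_kernel :: "(real \<Rightarrow> real) \<Rightarrow> 'a::real_inner \<Rightarrow> 'a \<Rightarrow> real" where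
  "isotropic_kernel f x y = f (cos (geodesic_dist x y / 2))"

lemma cos_geodesic_dist:
  assumes "x \<in> sphere 0 1" "y \<in> sphere 0 1"
  shows "cos (geodesic_dist x y / 2) = x \<bullet> y"
  using assms Cauchy_Schwarz_ineq2[of x y] by (simp add: geodesic_dist_def cos_arccos_abs)

text \<open>Only the values of \<open>f\<close> on \<open>[-1, 1]\<close> matter in the following two predicates;
  \<open>S\<close> is meant to be a unit sphere centred at the origin.\<close>

definition isotropic_part_pos_def :: "'a::real_inner set \<Rightarrow> (real \<Rightarrow> real) \<Rightarrow> bool" where
  "isotropic_part_pos_def S f \<longleftrightarrow>
     continuous_on {-1..1} f \<and> pos_def_kernel_on S (isotropic_kernel f)"

definition isotropic_part_strictly_pos_def :: "'a::real_inner set \<Rightarrow> (real \<Rightarrow> real) \<Rightarrow> bool" where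
  "isotropic_part_strictly_pos_def S f \<longleftrightarrow>
     continuous_on {-1..1} f \<and> strictly_pos_def_kernel_on S (isotropic_kernel f)"

text \<open>The Jacobi polynomial of degree \<open>n\<close> in the classical normalization, whose value at 1 is
  \<open>(real n + \<alpha>) gchoose n\<close>, by the explicit formula of Szego, Orthogonal Polynomials, (4.3.2).\<close>

definition jacobi_P :: "nat \<Rightarrow> real \<Rightarrow> real \<Rightarrow> real \<Rightarrow> real" where
  "jacobi_P n \<alpha> \<beta> t =
     (\<Sum>s\<le>n. ((real n + \<alpha>) gchoose (n - s)) * ((real n + \<beta>) gchoose s) *
             ((t - 1) / 2) ^ s * ((t + 1) / 2) ^ (n - s))"

text \<open>\<open>a\<close> is the sequence of Fourier--Jacobi coefficients of \<open>f\<close>, with respect to the Jacobi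
  polynomials belonging to the sphere of dimension \<open>d\<close>, as in Schoenberg's theorem.\<close>

definition schoenberg_series :: "nat \<Rightarrow> (real \<Rightarrow> real) \<Rightarrow> (nat \<Rightarrow> real) \<Rightarrow> bool" where
  "schoenberg_series d f a \<longleftrightarrow>
     (\<forall>k. a k \<ge> 0) \<and>
     summable (\<lambda>k. a k * jacobi_P k ((real d - 2) / 2) ((real d - 2) / 2) 1) \<and>
     (\<forall>t\<in>{-1..1}. (\<lambda>k. a k * jacobi_P k ((real d - 2) / 2) ((real d - 2) / 2) t) sums f t)"

end

theory Submission
  imports Defs
begin

text \<open>Expanding both series, the quadratic form of \<open>fg\<close> is the iterated sum of \<open>a\<^sub>k b\<^sub>l Q\<^sub>k\<^sub>l\<close>, where
  \<open>Q\<^sub>k\<^sub>l\<close> is the form of the kernel \<open>P\<^sub>k P\<^sub>l\<close>. Since \<open>P\<^sub>k (x \<bullet> y)\<close> is a finite Gram kernel, every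
  \<open>Q\<^sub>k\<^sub>l\<close> is nonnegative, so the form of \<open>fg\<close> vanishes only if all \<open>Q\<^sub>k\<^sub>l\<close> with \<open>a\<^sub>k b\<^sub>l > 0\<close> do.
  If \<open>k + l\<close> takes arbitrarily large even and odd values, then in the limit, \<open>P\<^sub>k P\<^sub>l / (P\<^sub>k P\<^sub>l) 1\<close> being
  negligible on \<open>]-1, 1[\<close>, the sum of the squares of the coefficients plus the contribution of the
  antipodal pairs and the same expression with a minus sign are both 0; hence so are all coefficients.
  Conversely, the alternating signs on the vertices of a regular \<open>2 q\<close>-gon annihilate every
  \<open>P\<^sub>k P\<^sub>l\<close> with \<open>k + l < q\<close> or \<open>k + l + q\<close> odd, so if only finitely many \<open>k + l\<close> of one parity occur, a
  large \<open>q\<close> of that parity shows that \<open>fg\<close> is not strictly positive definite.\<close>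

section \<open>The ultraspherical polynomials and their differential equation\<close>

definition ultra_coeff :: "nat \<Rightarrow> real \<Rightarrow> nat \<Rightarrow> real" where
  "ultra_coeff n \<alpha> s = ((real n + \<alpha>) gchoose (n - s)) * ((real n + \<alpha>) gchoose s)"

text \<open>A formal counterpart of \<open>jacobi_P n \<alpha> \<alpha>\<close>, with
  \<open>[:-1/2, 1/2:]\<close> for \<open>(t - 1) / 2\<close> and \<open>[:1/2, 1/2:]\<close> for
  \<open>(t + 1) / 2\<close>, so that derivatives, degrees and coefficients are at hand.\<close>

definition ultra_poly :: "nat \<Rightarrow> real \<Rightarrow> real poly" where
  "ultra_poly n \<alpha> =
     (\<Sum>s\<le>n. smult (ultra_coeff n \<alpha> s) ([:-1/2, 1/2:] ^ s * [:1/2, 1/2:] ^ (n - s)))"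

lemma poly_ultra_poly: "poly (ultra_poly n \<alpha>) t = jacobi_P n \<alpha> \<alpha> t"
  by (auto simp: ultra_poly_def jacobi_P_def ultra_coeff_def poly_sum field_simps intro!: sum.cong)

lemma gchoose_Suc_mult: "((x::real) gchoose Suc k) * (real k + 1) = (x - real k) * (x gchoose k)"
  using gbinomial_mult_1[of x k] by (simp add: algebra_simps)

lemma gchoose_pos:
  assumes "x > real k - 1" shows "((x::real) gchoose k) > 0"
  using assms by (auto simp: gbinomial_prod_rev intro!: divide_pos_pos prod_pos)

lemma ultra_coeff_pos: "\<lbrakk>\<alpha> \<ge> 0; s \<le> n\<rbrakk> \<Longrightarrow> ultra_coeff n \<alpha> s > 0"
  by (auto simp: ultra_coeff_def intro!: mult_pos_pos gchoose_pos)

lemma ultra_coeff_sym: "s \<le> n \<Longrightarrow> ultra_coeff n \<alpha> (n - s) = ultra_coeff n \<alpha> s"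
  by (simp add: ultra_coeff_def)

text \<open>Both binomial factors are shifted by \<open>gchoose_Suc_mult\<close>. This division-free
  ratio is what makes the sum in \<open>ultra_poly_ode\<close> telescope.\<close>

lemma ultra_coeff_Suc:
  assumes "s < n"
  shows "ultra_coeff n \<alpha> (Suc s) * (real (Suc s) * (real (Suc s) + \<alpha>)) =
         ultra_coeff n \<alpha> s * (real (n - s) * (real (n - s) + \<alpha>))"
proof -
  obtain m where m: "n = Suc (s + m)"
    using assms less_iff_Suc_add by auto
  let ?N = "real n + \<alpha>"
  have 1: "(?N gchoose Suc s) * (real s + 1) = (?N - real s) * (?N gchoose s)"
    by (rule gchoose_Suc_mult)
  have 2: "(?N gchoose Suc m) * (real m + 1) = (?N - real m) * (?N gchoose m)"
    by (rule gchoose_Suc_mult)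
  have "ultra_coeff n \<alpha> (Suc s) * (real (Suc s) * (real (Suc s) + \<alpha>))
      = ((?N gchoose Suc s) * (real s + 1)) * ((?N - real m) * (?N gchoose m))"
    by (simp add: ultra_coeff_def m algebra_simps)
  also have "\<dots> = ((?N - real s) * (?N gchoose s)) * ((?N gchoose Suc m) * (real m + 1))"
    unfolding 1 2 ..
  also have "\<dots> = ultra_coeff n \<alpha> s * (real (n - s) * (real (n - s) + \<alpha>))"
    by (simp add: ultra_coeff_def m algebra_simps)
  finally show ?thesis .
qed

text \<open>Reflection exchanges \<open>(t - 1) / 2\<close> and \<open>(t + 1) / 2\<close> up to
  sign; reversing the order of summation restores the terms because the coefficients are
  symmetric.\<close>

lemma jacobi_P_minus: "jacobi_P n \<alpha> \<alpha> (- t) = (- 1) ^ n * jacobi_P n \<alpha> \<alpha> t"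
proof -
  define T where "T t s = ultra_coeff n \<alpha> s * ((t - 1) / 2) ^ s * ((t + 1) / 2) ^ (n - s)"
    for t :: real and s
  have J: "jacobi_P n \<alpha> \<alpha> t = (\<Sum>s\<le>n. T t s)" for t
    by (simp add: jacobi_P_def T_def ultra_coeff_def)
  have "T (- t) (n - s) = (- 1) ^ n * T t s" if "s \<le> n" for s
  proof -
    have "(- t - 1) / 2 = (- 1) * ((t + 1) / 2)" "(- t + 1) / 2 = (- 1) * ((t - 1) / 2)"
      by (auto simp: field_simps)
    then have "T (- t) (n - s) = ultra_coeff n \<alpha> s * ((- 1) ^ (n - s) * ((t + 1) / 2) ^ (n - s))
        * ((- 1) ^ s * ((t - 1) / 2) ^ s)"
      using that by (simp only: T_def ultra_coeff_sym power_mult_distrib diff_diff_cancel)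
    also have "\<dots> = (- 1) ^ (n - s + s) * T t s"
      by (simp only: T_def power_add mult_ac)
    finally show ?thesis using that by simp
  qed
  then have "(\<Sum>s\<le>n. T (- t) (n - s)) = (- 1) ^ n * (\<Sum>s\<le>n. T t s)"
    by (simp add: sum_distrib_left)
  moreover have "(\<Sum>s\<le>n. T (- t) (n - s)) = (\<Sum>s\<le>n. T (- t) s)"
    using sum.nat_diff_reindex[of "T (-t)" "Suc n"] by (simp add: lessThan_Suc_atMost)
  ultimately show ?thesis by (simp add: J)
qed

section \<open>Value at 1, degree and coefficients\<close>

lemma jacobi_P_one: "jacobi_P n \<alpha> \<alpha> 1 = ultra_coeff n \<alpha> 0"
  by (simp add: jacobi_P_def ultra_coeff_def sum.atMost_shift)

lemma jacobi_P_one_pos: "\<alpha> \<ge> 0 \<Longrightarrow> jacobi_P n \<alpha> \<alpha> 1 > 0"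
  by (simp add: jacobi_P_one ultra_coeff_pos)

lemma degree_ultra_poly_le: "degree (ultra_poly n \<alpha>) \<le> n"
  unfolding ultra_poly_def
proof (intro degree_sum_le order.trans[OF degree_smult_le] order.trans[OF degree_mult_le])
  fix s assume "s \<in> {..n}"
  have "degree ([:-1/2, 1/2::real:] ^ s) + degree ([:1/2, 1/2::real:] ^ (n - s)) = s + (n - s)"
    by (subst (1 2) degree_power_eq) auto
  then show "degree ([:-1/2, 1/2::real:] ^ s) + degree ([:1/2, 1/2::real:] ^ (n - s)) \<le> n"
    using \<open>s \<in> {..n}\<close> by simp
qed simp

text \<open>Every summand has degree exactly \<open>n\<close>, the same leading coefficient and a
  positive weight, so nothing cancels. The positivity permits the division in
  \<open>zonal_gram\<close>.\<close>

lemma coeff_ultra_poly_top_pos: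
  assumes "\<alpha> \<ge> 0" shows "coeff (ultra_poly n \<alpha>) n > 0"
proof -
  have "coeff ([:-1/2, 1/2::real:] ^ s * [:1/2, 1/2:] ^ (n - s)) n = (1/2) ^ n" if "s \<le> n" for s
  proof -
    let ?p = "[:-1/2, 1/2::real:] ^ s * [:1/2, 1/2:] ^ (n - s)"
    have "degree ?p = n"
      using that by (subst degree_mult_eq) (auto simp: degree_power_eq)
    moreover have "lead_coeff ?p = (1/2) ^ n"
      using that by (simp only: lead_coeff_mult lead_coeff_power) (simp flip: power_add)
    ultimately show ?thesis by simp
  qed
  then have "coeff (ultra_poly n \<alpha>) n = (\<Sum>s\<le>n. ultra_coeff n \<alpha> s * (1/2) ^ n)"
    by (simp add: ultra_poly_def coeff_sum)
  also have "\<dots> > 0"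
    using assms by (auto intro!: sum_pos mult_pos_pos ultra_coeff_pos)
  finally show ?thesis .
qed

text \<open>The reflection formula \<open>jacobi_P_minus\<close> is compared coefficient by
  coefficient.\<close>

lemma coeff_ultra_poly_parity:
  assumes "coeff (ultra_poly n \<alpha>) m \<noteq> 0" shows "even (m + n)"
proof -
  let ?p = "ultra_poly n \<alpha>"
  have "poly (pcompose ?p [:0, - 1:]) t = poly (smult ((- 1) ^ n) ?p) t" for t
    by (simp add: poly_pcompose poly_ultra_poly jacobi_P_minus)
  then have "pcompose ?p [:0, - 1:] = smult ((- 1) ^ n) ?p"
    by (simp add: poly_eq_poly_eq_iff[symmetric] fun_eq_iff)
  moreover have "coeff (pcompose ?p [:0, - 1:]) m = (- 1) ^ m * coeff ?p m"
    using coeff_pcompose_linear[of ?p "-1" m] by simp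
  ultimately have "(- 1) ^ m * coeff ?p m = (- 1) ^ n * coeff ?p m" by (metis coeff_smult)
  then have "(- 1 :: real) ^ m = (- 1) ^ n" using assms by simp
  then show ?thesis by (cases "even m"; cases "even n") auto
qed

text \<open>This is the Gegenbauer equation. Its operator sends \<open>U ^ s * V ^ (n - s)\<close>
  to a combination of three neighbouring products of this kind, and with the weights of
  \<open>ultra_poly\<close> these combinations telescope.\<close>

lemma ultra_poly_ode:
  "[:1, 0, - 1:] * pderiv (pderiv (ultra_poly n \<alpha>))
   - smult (2 * (\<alpha> + 1)) ([:0, 1:] * pderiv (ultra_poly n \<alpha>))
   + smult (real n * (real n + 2 * \<alpha> + 1)) (ultra_poly n \<alpha>) = 0"
proof -
  define \<mu> where "\<mu> = real n * (real n + 2 * \<alpha> + 1)"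
  define L where "L p = [:1, 0, - 1:] * pderiv (pderiv p)
     - smult (2 * (\<alpha> + 1)) ([:0, 1:] * pderiv p) + smult \<mu> p" for p :: "real poly"
  define U V :: "real poly" where "U = [:-1/2, 1/2:]" and "V = [:1/2, 1/2:]"
  \<comment> \<open>Weights of the telescoping sum. The factor \<open>real s\<close> at 0 and the
    default value 0 beyond \<open>n\<close> make both end terms vanish.\<close>
  define C where "C s = (if s \<le> n then ultra_coeff n \<alpha> s * (real s * (real s + \<alpha>)) else 0)" for s
  define T where "T t s = ((t - 1) / 2) ^ s * ((t + 1) / 2) ^ (n - s)" for t :: real and s
  have L_sum: "L (\<Sum>s\<in>S. smult (c s) (p s)) = (\<Sum>s\<in>S. smult (c s) (L (p s)))"
    for S :: "nat set" and c p
  proof -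
    have add: "L (p + q) = L p + L q" for p q
      by (simp add: L_def pderiv_add smult_add_right algebra_simps del: mult_pCons_left)
    have smult: "L (smult c p) = smult c (L p)" for c p
      by (simp add: L_def pderiv_smult smult_add_right smult_diff_right mult.commute
          del: mult_pCons_left)
    have "L 0 = 0" by (simp add: L_def)
    then show ?thesis
      by (induction S rule: infinite_finite_induct) (simp_all add: add smult)
  qed
  have pd: "pderiv (U ^ s * V ^ m) = smult (1/2) (smult (real s) (U ^ (s - 1) * V ^ m)
              + smult (real m) (U ^ s * V ^ (m - 1)))" for s m
  proof -
    have "pderiv U = [:1/2:]" "pderiv V = [:1/2:]" by (auto simp: U_def V_def pderiv_pCons)
    then show ?thesis
      by (simp add: pderiv_mult pderiv_power smult_add_right algebra_simps)
  qed
  have key: "poly (L (U ^ s * V ^ m)) t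
      = - (real s * (real s + \<alpha>)) * (((t - 1) / 2) ^ (s - 1) * ((t + 1) / 2) ^ (m + 1))
        + (real s * (real s + \<alpha>) + real m * (real m + \<alpha>)) *
            (((t - 1) / 2) ^ s * ((t + 1) / 2) ^ m)
        - real m * (real m + \<alpha>) * (((t - 1) / 2) ^ (s + 1) * ((t + 1) / 2) ^ (m - 1))"
    if "s + m = n" for s m t
  proof -
    define u v where "u = (t - 1) / 2" and "v = (t + 1) / 2"
    \<comment> \<open>Written with \<open>u\<close> and \<open>v\<close>, all terms of the equation
      become homogeneous of degree \<open>s + m\<close>, so monomials can be compared
      directly.\<close>
    have t: "t = u + v" "(1 - t * t) / 4 = - (u * v)" and "v = u + 1"
      by (auto simp: u_def v_def field_simps)
    have \<mu>: "\<mu> = (real s + real m) * (real s + real m + 2 * \<alpha> + 1)"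
      using that by (auto simp: \<mu>_def)
    have UV: "poly U t = u" "poly V t = v" by (auto simp: U_def V_def u_def v_def field_simps)
    have pd1: "poly (pderiv (U ^ s * V ^ m)) t = (1/2) * (real s * (u ^ (s - 1) * v ^ m)
              + real m * (u ^ s * v ^ (m - 1)))" for s m
      by (simp add: pd UV)
    have pd2: "poly (pderiv (pderiv (U ^ s * V ^ m))) t =
        (1/2) * (real s * poly (pderiv (U ^ (s - 1) * V ^ m)) t
              + real m * poly (pderiv (U ^ s * V ^ (m - 1))) t)" for s m
      by (simp add: pd[of s m] pderiv_add pderiv_smult algebra_simps)
    have "poly (L (U ^ s * V ^ m)) t =
        (1 - t * t) / 4 * ((real s * (real (s - 1) * (u ^ (s - 1 - 1) * v ^ m)
                + real m * (u ^ (s - 1) * v ^ (m - 1)))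
              + real m * (real s * (u ^ (s - 1) * v ^ (m - 1))
                + real (m - 1) * (u ^ s * v ^ (m - 1 - 1)))))
        - (\<alpha> + 1) * (t * (real s * (u ^ (s - 1) * v ^ m) + real m * (u ^ s * v ^ (m - 1))))
        + \<mu> * (u ^ s * v ^ m)"
      by (simp only: L_def poly_add poly_diff poly_mult poly_smult poly_power UV pd1 pd2)
         (simp add: field_simps)
    also have "\<dots> = - (real s * (real s + \<alpha>)) * (u ^ (s - 1) * v ^ (m + 1))
        + (real s * (real s + \<alpha>) + real m * (real m + \<alpha>)) * (u ^ s * v ^ m)
        - real m * (real m + \<alpha>) * (u ^ (s + 1) * v ^ (m - 1))"
    proof -
      \<comment> \<open>Exponents such as \<open>s - 1 - 1\<close> are truncated; separating 0, 1
        and larger values removes the subtraction.\<close>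
      have cases: "k = 0 \<or> k = 1 \<or> (\<exists>k'. k = Suc (Suc k'))" for k :: nat
        by (metis One_nat_def not0_implies_Suc)
      show ?thesis
        unfolding t(2) \<mu> unfolding t(1)
        using cases[of s] cases[of m] by (elim disjE exE) (simp_all add: algebra_simps)
    qed
    finally show ?thesis by (simp add: u_def v_def)
  qed
  have "poly (L (ultra_poly n \<alpha>)) t = 0" for t
  proof -
    have "poly (L (ultra_poly n \<alpha>)) t =
        (\<Sum>s\<le>n. ultra_coeff n \<alpha> s * poly (L (U ^ s * V ^ (n - s))) t)"
      by (simp only: ultra_poly_def flip: U_def V_def) (simp only: L_sum poly_sum poly_smult)
    \<comment> \<open>By \<open>ultra_coeff_Suc\<close> the weight of the upper neighbour is
      \<open>C (Suc s)\<close>, so each summand is a difference of consecutive terms.\<close>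
    also have "\<dots> = (\<Sum>s\<le>n. C s * (T t s - T t (s - 1)) - C (Suc s) * (T t (Suc s) - T t s))"
    proof (rule sum.cong)
      fix s assume "s \<in> {..n}"
      then have "s \<le> n" by simp
      have C: "C (Suc s) = ultra_coeff n \<alpha> s * (real (n - s) * (real (n - s) + \<alpha>))"
        using ultra_coeff_Suc[of s n \<alpha>] \<open>s \<le> n\<close> by (cases "s < n") (auto simp: C_def)
      have B: "real (n - s) * (((t - 1) / 2) ^ (s + 1) * ((t + 1) / 2) ^ (n - s - 1)) =
               real (n - s) * T t (Suc s)"
        by (simp add: T_def)
      have A: "real s * (((t - 1) / 2) ^ (s - 1) * ((t + 1) / 2) ^ (n - s + 1)) =
               real s * T t (s - 1)"
        using \<open>s \<le> n\<close> by (cases s) (simp_all add: T_def Suc_diff_Suc Suc_diff_le)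
      have P: "poly (L (U ^ s * V ^ (n - s))) t = - (real s + \<alpha>) * (real s * T t (s - 1))
          + (real s * (real s + \<alpha>) + real (n - s) * (real (n - s) + \<alpha>)) * T t s
          - (real (n - s) + \<alpha>) * (real (n - s) * T t (Suc s))"
        unfolding A[symmetric] B[symmetric] using \<open>s \<le> n\<close>
        by (subst key) (simp_all add: T_def algebra_simps)
      show "ultra_coeff n \<alpha> s * poly (L (U ^ s * V ^ (n - s))) t =
            C s * (T t s - T t (s - 1)) - C (Suc s) * (T t (Suc s) - T t s)"
        unfolding P C using \<open>s \<le> n\<close> by (simp add: C_def algebra_simps)
    qed simp
    also have "\<dots> = C 0 * (T t 0 - T t (0 - 1)) - C (Suc n) * (T t (Suc n) - T t n)"
      using sum_telescope[of "\<lambda>s. C s * (T t s - T t (s - 1))" n] by simp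
    also have "\<dots> = 0"
      by (simp add: C_def)
    finally show ?thesis .
  qed
  then have "L (ultra_poly n \<alpha>) = 0"
    using poly_all_0_iff_0 by blast
  then show ?thesis by (simp add: L_def \<mu>_def)
qed

section \<open>Decay of the normalized polynomials inside the interval\<close>

definition ultra_normed :: "nat \<Rightarrow> real \<Rightarrow> real \<Rightarrow> real" where
  "ultra_normed n \<alpha> t = jacobi_P n \<alpha> \<alpha> t / jacobi_P n \<alpha> \<alpha> 1"

text \<open>The derivative with respect to the angle \<open>\<theta>\<close>, where
  \<open>t = cos \<theta>\<close>, not with respect to \<open>t\<close>.\<close>

definition ultra_deriv :: "nat \<Rightarrow> real \<Rightarrow> real \<Rightarrow> real" where
  "ultra_deriv n \<alpha> \<theta> =
     - sin \<theta> * poly (pderiv (ultra_poly n \<alpha>)) (cos \<theta>) / jacobi_P n \<alpha> \<alpha> 1"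

lemma ultra_ode:
  "(1 - t\<^sup>2) * poly (pderiv (pderiv (ultra_poly n \<alpha>))) t =
     2 * (\<alpha> + 1) * t * poly (pderiv (ultra_poly n \<alpha>)) t
     - real n * (real n + 2 * \<alpha> + 1) * jacobi_P n \<alpha> \<alpha> t"
  using arg_cong[OF ultra_poly_ode[of n \<alpha>], of "\<lambda>q. poly q t"]
  by (simp add: poly_ultra_poly[symmetric] algebra_simps power2_eq_square)

lemma has_derivative_ultra_normed_cos:
  "((\<lambda>\<theta>. ultra_normed n \<alpha> (cos \<theta>)) has_field_derivative ultra_deriv n \<alpha> \<theta>) (at \<theta>)"
  unfolding ultra_normed_def ultra_deriv_def poly_ultra_poly[symmetric, of n \<alpha> "cos _"]
  using DERIV_cdivide[OF DERIV_chain2[OF poly_DERIV[of "ultra_poly n \<alpha>"] DERIV_cos[of \<theta>]]]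
  by (simp add: mult.commute)

text \<open>In the angle the equation reads
  \<open>y'' + (2 * \<alpha> + 1) * cot \<theta> * y' + \<mu> * y = 0\<close> with
  \<open>\<mu> = n * (n + 2 * \<alpha> + 1)\<close>: an oscillator that is damped where the
  cotangent is positive. The energy estimates below rest on this form.\<close>

lemma has_derivative_ultra_deriv:
  assumes "sin \<theta> \<noteq> 0"
  shows "(ultra_deriv n \<alpha> has_field_derivative
     - (2 * \<alpha> + 1) * (cos \<theta> / sin \<theta>) * ultra_deriv n \<alpha> \<theta>
     - real n * (real n + 2 * \<alpha> + 1) * ultra_normed n \<alpha> (cos \<theta>)) (at \<theta>)"
proof -
  let ?p = "ultra_poly n \<alpha>"
  have "(ultra_deriv n \<alpha> has_field_derivative
      ((1 - (cos \<theta>)\<^sup>2) * poly (pderiv (pderiv ?p)) (cos \<theta>) - cos \<theta> * poly (pderiv ?p) (cos \<theta>))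
        / jacobi_P n \<alpha> \<alpha> 1) (at \<theta>)"
    unfolding ultra_deriv_def[abs_def] sin_squared_eq[symmetric]
    using DERIV_cdivide[OF DERIV_mult[OF DERIV_minus[OF DERIV_sin]
        DERIV_chain2[OF poly_DERIV[of "pderiv ?p"] DERIV_cos]], of "jacobi_P n \<alpha> \<alpha> 1" \<theta>]
    by (simp add: power2_eq_square algebra_simps)
  also have "((1 - (cos \<theta>)\<^sup>2) * poly (pderiv (pderiv ?p)) (cos \<theta>)
        - cos \<theta> * poly (pderiv ?p) (cos \<theta>)) / jacobi_P n \<alpha> \<alpha> 1 =
      - (2 * \<alpha> + 1) * (cos \<theta> / sin \<theta>) * ultra_deriv n \<alpha> \<theta>
      - real n * (real n + 2 * \<alpha> + 1) * ultra_normed n \<alpha> (cos \<theta>)"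
    unfolding ultra_ode using assms
    by (simp add: ultra_deriv_def ultra_normed_def add_divide_distrib diff_divide_distrib
        algebra_simps)
  finally show ?thesis .
qed

lemma ultra_normed_one: "\<alpha> \<ge> 0 \<Longrightarrow> ultra_normed n \<alpha> 1 = 1"
  using jacobi_P_one_pos[of \<alpha> n] by (simp add: ultra_normed_def)

lemma ultra_normed_minus: "ultra_normed n \<alpha> (- t) = (- 1) ^ n * ultra_normed n \<alpha> t"
  by (simp add: ultra_normed_def jacobi_P_minus)

text \<open>Sonin's function of the equation in \<open>\<theta>\<close> decreases on \<open>[0, pi / 2]\<close>.\<close>

lemma sonin_le_one:
  assumes "\<alpha> \<ge> 0" "n > 0" "0 \<le> \<theta>" "\<theta> \<le> pi / 2"
  shows "(ultra_normed n \<alpha> (cos \<theta>))\<^sup>2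
    + (ultra_deriv n \<alpha> \<theta>)\<^sup>2 / (real n * (real n + 2 * \<alpha> + 1)) \<le> 1"
proof -
  define \<mu> where "\<mu> = real n * (real n + 2 * \<alpha> + 1)"
  define y where "y \<theta> = ultra_normed n \<alpha> (cos \<theta>)" for \<theta>
  define z where "z = ultra_deriv n \<alpha>"
  define E where "E \<theta> = (y \<theta>)\<^sup>2 + (z \<theta>)\<^sup>2 / \<mu>" for \<theta>
  have \<mu>: "\<mu> > 0" using assms(1,2) by (auto simp: \<mu>_def intro!: mult_pos_pos)
  have dy: "(y has_field_derivative z \<theta>) (at \<theta>)" for \<theta>
    unfolding y_def[abs_def] z_def by (rule has_derivative_ultra_normed_cos)
  have dz: "(z has_field_derivative - (2 * \<alpha> + 1) * (cos \<theta> / sin \<theta>) * z \<theta> - \<mu> * y \<theta>) (at \<theta>)"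
    if "sin \<theta> \<noteq> 0" for \<theta>
    using has_derivative_ultra_deriv[OF that, of n \<alpha>] unfolding z_def y_def \<mu>_def .
  \<comment> \<open>The cross terms in \<open>y * z\<close> from the two squares cancel, and only
    the damping term is left.\<close>
  have dE: "(E has_field_derivative - (2 * (2 * \<alpha> + 1) * (cos \<theta> / sin \<theta>) * (z \<theta>)\<^sup>2 / \<mu>)) (at \<theta>)"
    if "sin \<theta> \<noteq> 0" for \<theta>
  proof -
    have "(E has_field_derivative 2 * (z \<theta> * y \<theta>)
        + 2 * ((- (2 * \<alpha> + 1) * (cos \<theta> / sin \<theta>) * z \<theta> - \<mu> * y \<theta>) * z \<theta>) / \<mu>) (at \<theta>)"
      unfolding E_def[abs_def]
      using DERIV_add[OF DERIV_power[OF dy, of 2]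
          DERIV_cdivide[OF DERIV_power[OF dz[OF that], of 2], of \<mu>]] by simp
    also have "2 * (z \<theta> * y \<theta>)
        + 2 * ((- (2 * \<alpha> + 1) * (cos \<theta> / sin \<theta>) * z \<theta> - \<mu> * y \<theta>) * z \<theta>) / \<mu> =
        - (2 * (2 * \<alpha> + 1) * (cos \<theta> / sin \<theta>) * (z \<theta>)\<^sup>2 / \<mu>)"
    proof -
      have "2 * (a * b) + 2 * ((- k * q * a - \<mu> * b) * a) / \<mu> = - (2 * k * q * a\<^sup>2 / \<mu>)"
        for a b k q
        using \<mu> by (simp add: field_simps power2_eq_square)
      then show ?thesis by blast
    qed
    finally show ?thesis .
  qed
  have "E \<theta> \<le> E 0"
  \<comment> \<open>The cotangent is singular at 0, so the derivative is inspected on the open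
    interval only and continuity covers the end points.\<close>
  proof (rule DERIV_nonpos_imp_decreasing_open[OF assms(3)])
    fix x assume x: "0 < x" "x < \<theta>"
    then have "cos x \<ge> 0" "sin x > 0"
      using assms(4) by (auto intro!: cos_ge_zero sin_gt_zero)
    then have "2 * (2 * \<alpha> + 1) * (cos x / sin x) * (z x)\<^sup>2 / \<mu> \<ge> 0"
      using assms(1) \<mu> by (intro divide_nonneg_pos mult_nonneg_nonneg) auto
    then show "\<exists>y. (E has_real_derivative y) (at x) \<and> y \<le> 0"
      using dE[of x] \<open>sin x > 0\<close> by (intro exI[of _ "- (2 * (2 * \<alpha> + 1) * (cos x / sin x) * (z x)\<^sup>2 / \<mu>)"]) auto
  next
    show "continuous_on {0..\<theta>} E"
      unfolding E_def[abs_def] y_def z_def ultra_normed_def ultra_deriv_def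
        poly_ultra_poly[symmetric, of n \<alpha> "cos _"]
      using \<mu> jacobi_P_one_pos[OF assms(1), of n] by (intro continuous_intros) auto
  qed
  also have "E 0 = 1"
    using ultra_normed_one[OF assms(1), of n] by (simp add: E_def y_def z_def ultra_deriv_def)
  finally show ?thesis by (simp add: E_def y_def z_def \<mu>_def)
qed

text \<open>The square of the polynomial is one of the two nonnegative terms of Sonin's function;
  reflection reaches negative \<open>t\<close>. Degree 0, where that function would have denominator
  0, is treated apart.\<close>

lemma abs_ultra_normed_le:
  assumes "\<alpha> \<ge> 0" "\<bar>t\<bar> \<le> 1"
  shows "\<bar>ultra_normed n \<alpha> t\<bar> \<le> 1"
proof (cases "n = 0")
  case False
  have *: "\<bar>ultra_normed n \<alpha> t\<bar> \<le> 1" if "0 \<le> t" "t \<le> 1" for t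
  proof -
    have "(ultra_normed n \<alpha> t)\<^sup>2
        + (ultra_deriv n \<alpha> (arccos t))\<^sup>2 / (real n * (real n + 2 * \<alpha> + 1)) \<le> 1"
      using sonin_le_one[of \<alpha> n "arccos t"] arccos_le_pi2[of t] assms False that
      by (simp add: arccos_lbound)
    moreover have "(ultra_deriv n \<alpha> (arccos t))\<^sup>2 / (real n * (real n + 2 * \<alpha> + 1)) \<ge> 0"
      using assms by simp
    ultimately have "(ultra_normed n \<alpha> t)\<^sup>2 \<le> 1" by linarith
    then show ?thesis by (simp add: abs_square_le_1)
  qed
  show ?thesis
    using *[of t] *[of "- t"] assms by (cases "t \<ge> 0") (auto simp: ultra_normed_minus abs_mult)
qed (simp add: ultra_normed_def jacobi_P_def)

text \<open>With \<open>y\<close> the polynomial in the variable \<open>\<theta>\<close> and \<open>S\<close> Sonin's function, the derivative of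
  \<open>sin \<theta> * S + cos \<theta> * y y' / \<mu>\<close> is bounded above by \<open>O(1 / n)\<close> on \<open>[\<epsilon>, pi / 2]\<close>, and at \<open>\<epsilon>\<close> it is at most \<open>sin \<epsilon> + O(1 / n)\<close>.\<close>

lemma ultra_normed_bound:
  assumes "\<alpha> \<ge> 0" "n > 0" "0 < \<epsilon>" "\<epsilon> \<le> \<theta>" "\<theta> \<le> pi / 2"
  shows "sin \<theta> * (ultra_normed n \<alpha> (cos \<theta>))\<^sup>2
     \<le> sin \<epsilon> + (2 + 2 * (1 + (2 * \<alpha> + 1) / sin \<epsilon>)) / real n"
proof -
  define \<mu> where "\<mu> = real n * (real n + 2 * \<alpha> + 1)"
  define y where "y \<theta> = ultra_normed n \<alpha> (cos \<theta>)" for \<theta>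
  define z where "z = ultra_deriv n \<alpha>"
  define S where "S \<theta> = (y \<theta>)\<^sup>2 + (z \<theta>)\<^sup>2 / \<mu>" for \<theta>
  define E where "E \<theta> = y \<theta> * z \<theta> / \<mu>" for \<theta>
  define F where "F \<theta> = sin \<theta> * S \<theta> + cos \<theta> * E \<theta>" for \<theta>
  define C where "C = (1 + (2 * \<alpha> + 1) / sin \<epsilon>) / real n"
  have \<mu>: "\<mu> > 0" using assms(1,2) by (auto simp: \<mu>_def intro!: mult_pos_pos)
  have sin_pos: "sin x > 0" if "\<epsilon> \<le> x" "x \<le> \<theta>" for x
    using that assms by (intro sin_gt_zero) auto
  have cos_nonneg: "cos x \<ge> 0" if "\<epsilon> \<le> x" "x \<le> \<theta>" for x
    using that assms by (intro cos_ge_zero) auto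
  have S1: "S x \<le> 1" if "\<epsilon> \<le> x" "x \<le> \<theta>" for x
    using that assms sonin_le_one[of \<alpha> n x] by (simp add: S_def y_def z_def \<mu>_def)
  \<comment> \<open>\<open>S1\<close> bounds both \<open>(y x)\<^sup>2\<close> and
    \<open>(z x)\<^sup>2 / \<mu>\<close> by 1, and \<open>\<mu>\<close> is at least the square of
    \<open>n\<close>.\<close>
  have E1: "\<bar>E x\<bar> \<le> 1 / real n" if "\<epsilon> \<le> x" "x \<le> \<theta>" for x
  proof -
    have n2: "(real n)\<^sup>2 \<le> \<mu>"
      using assms(1) by (simp add: \<mu>_def power2_eq_square mult_left_mono)
    have "(z x)\<^sup>2 / \<mu> \<le> 1" "(y x)\<^sup>2 \<le> 1"
      using S1[OF that] divide_nonneg_pos[OF zero_le_power2[of "z x"] \<mu>]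
        zero_le_power2[of "y x"] unfolding S_def by (linarith, linarith)
    then have "(E x)\<^sup>2 \<le> 1 / \<mu>"
      using \<mu> mult_mono[of "(y x)\<^sup>2" 1 "(z x)\<^sup>2 / \<mu>" 1]
      by (simp add: E_def power_mult_distrib power_divide divide_simps power2_eq_square mult_ac)
    also have "1 / \<mu> \<le> (1 / real n)\<^sup>2"
      using n2 assms(2) by (simp add: power_divide frac_le)
    finally show ?thesis using abs_le_square_iff[of "E x" "1 / real n"] by simp
  qed
  have dy: "(y has_field_derivative z \<theta>) (at \<theta>)" for \<theta>
    unfolding y_def[abs_def] z_def by (rule has_derivative_ultra_normed_cos)
  have dF: "\<exists>D. (F has_field_derivative D) (at x) \<and> D \<le> C" if x: "\<epsilon> \<le> x" "x \<le> \<theta>" for x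
  proof -
    define s c u v where "s = sin x" and "c = cos x" and "u = y x" and "v = z x"
    define w where "w = - (2 * \<alpha> + 1) * (c / s) * v - \<mu> * u"
    have s: "s > 0" "sin \<epsilon> \<le> s" and c: "c \<ge> 0" "c \<le> 1"
      using sin_pos[OF x] cos_nonneg[OF x] sin_monotone_2pi_le[of \<epsilon> x] x assms
      by (auto simp: s_def c_def)
    have sc: "s\<^sup>2 + c\<^sup>2 = 1" by (simp add: s_def c_def)
    have dz: "(z has_field_derivative w) (at x)"
      using has_derivative_ultra_deriv[of x n \<alpha>] s
      unfolding z_def y_def \<mu>_def w_def u_def v_def s_def c_def by auto
    have dS: "(S has_field_derivative 2 * (v * u) + 2 * (w * v) / \<mu>) (at x)"
      unfolding S_def[abs_def]
      using DERIV_add[OF DERIV_power[OF dy, of 2]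
          DERIV_cdivide[OF DERIV_power[OF dz, of 2], of \<mu>]] by (simp add: u_def v_def)
    have dEx: "(E has_field_derivative (v * v + w * u) / \<mu>) (at x)"
      unfolding E_def[abs_def]
      using DERIV_cdivide[OF DERIV_mult[OF dy dz], of \<mu>] by (simp add: u_def v_def)
    have "(F has_field_derivative c * S x + (2 * (v * u) + 2 * (w * v) / \<mu>) * s
        + (- s * E x + (v * v + w * u) / \<mu> * c)) (at x)"
      unfolding F_def[abs_def]
      using DERIV_add[OF DERIV_mult[OF DERIV_sin dS] DERIV_mult[OF DERIV_cos dEx]]
      by (simp add: s_def c_def)
    moreover have "c * S x + (2 * (v * u) + 2 * (w * v) / \<mu>) * s
        + (- s * E x + (v * v + w * u) / \<mu> * c) \<le> C"
    proof -
      have S: "S x = u * u + v * v / \<mu>" and E: "E x = u * v / \<mu>"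
        by (simp_all add: S_def E_def u_def v_def power2_eq_square)
      have wv: "w * v / \<mu> * s = - ((2 * \<alpha> + 1) * (c * (v * v / \<mu>))) - s * (u * v)"
      proof -
        have "w * v = - ((2 * \<alpha> + 1) * (c * (v * v))) / s - \<mu> * (u * v)"
          using s by (simp add: w_def field_simps)
        then show ?thesis using s \<mu> by (simp add: diff_divide_distrib left_diff_distrib)
      qed
      have wu: "w * u / \<mu> = - ((2 * \<alpha> + 1) * (c / s) * (u * v / \<mu>)) - u * u"
      proof -
        have "w * u = - ((2 * \<alpha> + 1) * (c / s) * (u * v)) - \<mu> * (u * u)"
          by (simp add: w_def algebra_simps)
        then show ?thesis using \<mu> by (simp add: diff_divide_distrib)
      qed
      have "c * S x + (2 * (v * u) + 2 * (w * v) / \<mu>) * s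
          + (- s * E x + (v * v + w * u) / \<mu> * c)
        = c * (u * u) + 2 * (c * (v * v / \<mu>)) + 2 * (s * (u * v)) + 2 * (w * v / \<mu> * s)
          - s * E x + c * (w * u / \<mu>)"
        unfolding S by (simp add: algebra_simps add_divide_distrib)
      \<comment> \<open>The correction \<open>cos \<theta> * E \<theta>\<close> in \<open>F\<close>
        serves to cancel \<open>c * (u * u)\<close>; the terms \<open>s * (u * v)\<close> cancel
        within the derivative of \<open>S\<close>. A nonpositive term and multiples of the small
        quantity \<open>E x\<close> remain.\<close>
      also have "\<dots> = - (4 * \<alpha> * c * (v * v / \<mu>)) - s * E x - (2 * \<alpha> + 1) * (c * c / s) * E x"
        unfolding wv wu E by (simp add: algebra_simps add_divide_distrib)
      also have "\<dots> \<le> 0 + 1 * (1 / real n) + (2 * \<alpha> + 1) * (1 / sin \<epsilon>) * (1 / real n)"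
      proof -
        have 1: "4 * \<alpha> * c * (v * v / \<mu>) \<ge> 0"
          using assms(1) \<mu> c by simp
        have 2: "- (s * E x) \<le> 1 * (1 / real n)"
        proof -
          have "- (s * E x) \<le> s * \<bar>E x\<bar>"
            using mult_left_mono[of "- E x" "\<bar>E x\<bar>" s] s by simp
          also have "\<dots> \<le> 1 * (1 / real n)"
            using E1[OF x] s by (intro mult_mono) (auto simp: s_def)
          finally show ?thesis .
        qed
        have "c * c / s \<le> 1 / sin \<epsilon>"
          using s c sin_pos[of \<epsilon>] assms by (intro frac_le) (auto intro: mult_le_one)
        then have 3: "- ((2 * \<alpha> + 1) * (c * c / s) * E x) \<le> (2 * \<alpha> + 1) * (1 / sin \<epsilon>) * (1 / real n)"
        proof -
          have "- ((2 * \<alpha> + 1) * (c * c / s) * E x) \<le> (2 * \<alpha> + 1) * (c * c / s) * \<bar>E x\<bar>"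
            using mult_left_mono[of "- E x" "\<bar>E x\<bar>" "(2 * \<alpha> + 1) * (c * c / s)"] s assms(1)
            by simp
          also have "\<dots> \<le> (2 * \<alpha> + 1) * (1 / sin \<epsilon>) * (1 / real n)"
            using E1[OF x] s c assms(1) \<open>c * c / s \<le> 1 / sin \<epsilon>\<close> sin_pos[of \<epsilon>] assms(4)
            by (intro mult_mono mult_nonneg_nonneg) auto
          finally show ?thesis .
        qed
        from 1 2 3 show ?thesis by linarith
      qed
      also have "\<dots> = C" by (simp add: C_def divide_inverse algebra_simps)
      finally show ?thesis .
    qed
    ultimately show ?thesis by blast
  qed
  have C0: "C \<ge> 0"
    using assms sin_pos[of \<epsilon>] by (auto simp: C_def)
  \<comment> \<open>A function of slope at most \<open>C\<close> grows by at most
    \<open>C * (\<theta> - \<epsilon>)\<close>.\<close>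
  have "F \<theta> - C * \<theta> \<le> F \<epsilon> - C * \<epsilon>"
  proof (rule DERIV_nonpos_imp_nonincreasing[OF assms(4)])
    fix x assume "\<epsilon> \<le> x" "x \<le> \<theta>"
    then obtain D where D: "(F has_field_derivative D) (at x)" "D \<le> C" using dF by blast
    then have "((\<lambda>x. F x - C * x) has_field_derivative D - C) (at x)"
      by (auto intro!: derivative_eq_intros)
    with D(2) show "\<exists>y. ((\<lambda>x. F x - C * x) has_real_derivative y) (at x) \<and> y \<le> 0"
      by (intro exI[of _ "D - C"]) auto
  qed
  moreover have "C * \<theta> - C * \<epsilon> \<le> C * 2"
  proof -
    have "\<theta> - \<epsilon> \<le> 2" using assms pi_less_4 by linarith
    then show ?thesis using C0 by (metis mult_left_mono right_diff_distrib)
  qed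
  moreover have "cos \<epsilon> * E \<epsilon> \<le> 1 / real n" "- (cos \<theta> * E \<theta>) \<le> 1 / real n"
  proof -
    have *: "\<bar>cos x * E x\<bar> \<le> 1 / real n" if "\<epsilon> \<le> x" "x \<le> \<theta>" for x
      using mult_mono[of "\<bar>cos x\<bar>" 1 "\<bar>E x\<bar>" "1 / real n"] E1[OF that] by (simp add: abs_mult)
    show "cos \<epsilon> * E \<epsilon> \<le> 1 / real n" "- (cos \<theta> * E \<theta>) \<le> 1 / real n"
      using *[of \<epsilon>] *[of \<theta>] assms(4) by auto
  qed
  moreover have "sin \<epsilon> * S \<epsilon> \<le> sin \<epsilon>"
    using S1[of \<epsilon>] sin_pos[of \<epsilon>] assms(4) by (simp add: mult_le_cancel_left1)
  moreover have "sin \<theta> * (y \<theta>)\<^sup>2 \<le> sin \<theta> * S \<theta>"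
    using \<mu> sin_pos[of \<theta>] assms(4) by (intro mult_left_mono) (auto simp: S_def)
  ultimately have "sin \<theta> * (y \<theta>)\<^sup>2 \<le> sin \<epsilon> + C * 2 + 2 * (1 / real n)"
    unfolding F_def by linarith
  then show ?thesis
    by (simp add: y_def C_def add_divide_distrib algebra_simps)
qed

text \<open>For a fixed angle, \<open>\<epsilon>\<close> is first taken small, which controls
  \<open>sin \<epsilon>\<close> in \<open>ultra_normed_bound\<close>, and then \<open>n\<close>
  large, which controls the rest. Reflection handles negative \<open>t\<close>.\<close>

lemma ultra_normed_tendsto_0:
  assumes "\<alpha> \<ge> 0" "\<bar>t\<bar> < 1"
  shows "(\<lambda>n. ultra_normed n \<alpha> t) \<longlonglongrightarrow> 0"
proof -
  have *: "(\<lambda>n. ultra_normed n \<alpha> t) \<longlonglongrightarrow> 0" if t: "0 \<le> t" "t < 1" for t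
  proof -
    define \<theta> where "\<theta> = arccos t"
    have \<theta>: "0 < \<theta>" "\<theta> \<le> pi / 2" "cos \<theta> = t"
      using t arccos_lt_bounded[of t] arccos_le_pi2[of t] by (auto simp: \<theta>_def)
    have sin: "sin \<theta> > 0" using \<theta> by (intro sin_gt_zero) auto
    have "(\<lambda>n. sin \<theta> * (ultra_normed n \<alpha> t)\<^sup>2) \<longlonglongrightarrow> 0"
    proof (rule LIMSEQ_I)
      fix r :: real assume "r > 0"
      \<comment> \<open>The minimum with \<open>\<theta>\<close> keeps \<open>\<epsilon>\<close>
        admissible in \<open>ultra_normed_bound\<close>; the other bound spends half of the
        tolerance on \<open>sin \<epsilon>\<close>.\<close>
      define \<epsilon> where "\<epsilon> = min \<theta> (r / 2)"
      have \<epsilon>: "0 < \<epsilon>" "\<epsilon> \<le> \<theta>" "\<epsilon> \<le> r / 2" using \<open>r > 0\<close> \<theta> by (auto simp: \<epsilon>_def)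
      have "(\<lambda>n. (2 + 2 * (1 + (2 * \<alpha> + 1) / sin \<epsilon>)) / real n) \<longlonglongrightarrow> 0"
        by (rule lim_const_over_n)
      then have "eventually (\<lambda>n. (2 + 2 * (1 + (2 * \<alpha> + 1) / sin \<epsilon>)) / real n < r / 2) sequentially"
        using \<open>r > 0\<close> by (auto dest: order_tendstoD(2)[where a = "r / 2"])
      then have "eventually (\<lambda>n. norm (sin \<theta> * (ultra_normed n \<alpha> t)\<^sup>2 - 0) < r) sequentially"
        using eventually_gt_at_top[of "0::nat"]
      proof eventually_elim
        case (elim n)
        have "sin \<theta> * (ultra_normed n \<alpha> t)\<^sup>2
            \<le> sin \<epsilon> + (2 + 2 * (1 + (2 * \<alpha> + 1) / sin \<epsilon>)) / real n"
          using ultra_normed_bound[of \<alpha> n \<epsilon> \<theta>] assms(1) elim(2) \<epsilon> \<theta> by simp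
        moreover have "sin \<epsilon> \<le> \<epsilon>" using \<epsilon> by (intro sin_x_le_x) auto
        ultimately have "sin \<theta> * (ultra_normed n \<alpha> t)\<^sup>2 < r" using elim(1) \<epsilon>(3) by linarith
        then show ?case using sin by simp
      qed
      then show "\<exists>no. \<forall>n\<ge>no. norm (sin \<theta> * (ultra_normed n \<alpha> t)\<^sup>2 - 0) < r"
        by (simp add: eventually_sequentially)
    qed
    from tendsto_divide[OF this tendsto_const[of "sin \<theta>"]] sin
    have "(\<lambda>n. (ultra_normed n \<alpha> t)\<^sup>2) \<longlonglongrightarrow> 0" by simp
    from tendsto_real_sqrt[OF this] show ?thesis
      by (simp add: tendsto_rabs_zero_iff)
  qed
  show ?thesis
  proof (cases "t \<ge> 0")
    case True
    then show ?thesis using * assms by auto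
  next
    case False
    then have "(\<lambda>n. \<bar>ultra_normed n \<alpha> (- t)\<bar>) \<longlonglongrightarrow> 0"
      using *[of "- t"] assms tendsto_rabs_zero by auto
    then show ?thesis by (simp add: ultra_normed_minus abs_mult tendsto_rabs_zero_iff)
  qed
qed

section \<open>Directional derivatives and the Laplacian of polynomial functions\<close>

text \<open>Built on the total operator \<open>deriv\<close> so that it can be iterated on
  functions; for polynomial functions \<open>has_dirderiv\<close> shows that it is a genuine
  derivative.\<close>

definition dirderiv :: "'a \<Rightarrow> ('a::euclidean_space \<Rightarrow> real) \<Rightarrow> 'a \<Rightarrow> real" where
  "dirderiv b \<phi> x = deriv (\<lambda>t. \<phi> (x + t *\<^sub>R b)) 0"

lemma dirderiv_eqI:
  assumes "((\<lambda>t. \<phi> (x + t *\<^sub>R b)) has_field_derivative D) (at 0)"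
  shows "dirderiv b \<phi> x = D"
  unfolding dirderiv_def using assms by (rule DERIV_imp_deriv)

text \<open>Induction on the generation of polynomial functions. Carrying a polynomial derivative
  through the induction yields differentiability and closure under \<open>dirderiv\<close>
  together.\<close>

lemma real_polynomial_function_dirderiv_aux:
  assumes "real_polynomial_function \<phi>"
  shows "\<exists>\<psi>. real_polynomial_function \<psi> \<and>
           (\<forall>x. ((\<lambda>t. \<phi> (x + t *\<^sub>R b)) has_field_derivative \<psi> x) (at 0))"
  using assms
proof (induction \<phi> rule: real_polynomial_function.induct)
  case (linear h)
  then interpret bounded_linear h .
  have "((\<lambda>t. h (x + t *\<^sub>R b)) has_field_derivative h b) (at 0)" for x
    by (auto simp: add scaleR intro!: derivative_eq_intros)
  then show ?case by (intro exI[of _ "\<lambda>_. h b"]) (auto intro: real_polynomial_function.intros(2))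
next
  case (const c)
  show ?case by (intro exI[of _ "\<lambda>_. 0"]) (auto intro: real_polynomial_function.intros(2))
next
  case (add f g)
  then obtain f' g' where "real_polynomial_function f'" "real_polynomial_function g'"
    "\<And>x. ((\<lambda>t. f (x + t *\<^sub>R b)) has_field_derivative f' x) (at 0)"
    "\<And>x. ((\<lambda>t. g (x + t *\<^sub>R b)) has_field_derivative g' x) (at 0)" by blast
  then show ?case
    by (intro exI[of _ "\<lambda>x. f' x + g' x"])
       (auto intro: real_polynomial_function.intros(3) derivative_intros)
next
  case (mult f g)
  then obtain f' g' where *: "real_polynomial_function f'" "real_polynomial_function g'"
    "\<And>x. ((\<lambda>t. f (x + t *\<^sub>R b)) has_field_derivative f' x) (at 0)"
    "\<And>x. ((\<lambda>t. g (x + t *\<^sub>R b)) has_field_derivative g' x) (at 0)" by blast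
  have "((\<lambda>t. f (x + t *\<^sub>R b) * g (x + t *\<^sub>R b)) has_field_derivative
          f' x * g x + g' x * f x) (at 0)" for x
    using DERIV_mult[OF *(3)[of x] *(4)[of x]] by simp
  with * mult.hyps show ?case
    by (intro exI[of _ "\<lambda>x. f' x * g x + g' x * f x"])
       (auto intro!: real_polynomial_function.intros(3) real_polynomial_function.intros(4))
qed

lemma has_dirderiv:
  assumes "real_polynomial_function \<phi>"
  shows "((\<lambda>t. \<phi> (x + t *\<^sub>R b)) has_field_derivative dirderiv b \<phi> x) (at 0)"
  using real_polynomial_function_dirderiv_aux[OF assms, of b] dirderiv_eqI by metis

lemma real_polynomial_function_dirderiv:
  assumes "real_polynomial_function \<phi>"
  shows "real_polynomial_function (dirderiv b \<phi>)"
proof -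
  obtain \<psi> where \<psi>: "real_polynomial_function \<psi>"
      "\<And>x. ((\<lambda>t. \<phi> (x + t *\<^sub>R b)) has_field_derivative \<psi> x) (at 0)"
    using real_polynomial_function_dirderiv_aux[OF assms] by blast
  then have "dirderiv b \<phi> = \<psi>" by (intro ext dirderiv_eqI)
  with \<psi> show ?thesis by simp
qed

definition laplacian :: "('a::euclidean_space \<Rightarrow> real) \<Rightarrow> 'a \<Rightarrow> real" where
  "laplacian \<phi> x = (\<Sum>b\<in>Basis. dirderiv b (dirderiv b \<phi>) x)"

lemma real_polynomial_function_lincomb:
  assumes "\<And>i. i \<in> I \<Longrightarrow> real_polynomial_function (\<phi> i)"
  shows "real_polynomial_function (\<lambda>x. \<Sum>i\<in>I. c i * \<phi> i x)"
  using assms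
  by (induction I rule: infinite_finite_induct) (auto intro!: real_polynomial_function.intros(2-4))

lemma dirderiv_lincomb:
  assumes "\<And>i. i \<in> I \<Longrightarrow> real_polynomial_function (\<phi> i)"
  shows "dirderiv b (\<lambda>x. \<Sum>i\<in>I. c i * \<phi> i x) = (\<lambda>x. \<Sum>i\<in>I. c i * dirderiv b (\<phi> i) x)"
  using assms by (intro ext dirderiv_eqI DERIV_sum DERIV_cmult has_dirderiv)

lemma laplacian_lincomb:
  assumes "\<And>i. i \<in> I \<Longrightarrow> real_polynomial_function (\<phi> i)"
  shows "laplacian (\<lambda>x. \<Sum>i\<in>I. c i * \<phi> i x) = (\<lambda>x. \<Sum>i\<in>I. c i * laplacian (\<phi> i) x)"
proof
  fix x
  have "laplacian (\<lambda>x. \<Sum>i\<in>I. c i * \<phi> i x) x =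
      (\<Sum>b\<in>Basis. \<Sum>i\<in>I. c i * dirderiv b (dirderiv b (\<phi> i)) x)"
    using assms by (simp add: laplacian_def dirderiv_lincomb real_polynomial_function_dirderiv)
  also have "\<dots> = (\<Sum>i\<in>I. c i * laplacian (\<phi> i) x)"
    by (subst sum.swap) (simp add: laplacian_def sum_distrib_left)
  finally show "laplacian (\<lambda>x. \<Sum>i\<in>I. c i * \<phi> i x) x = (\<Sum>i\<in>I. c i * laplacian (\<phi> i) x)" .
qed

lemma real_polynomial_function_laplacian:
  assumes "real_polynomial_function \<phi>"
  shows "real_polynomial_function (laplacian \<phi>)"
  using real_polynomial_function_lincomb[of Basis "\<lambda>b. dirderiv b (dirderiv b \<phi>)" "\<lambda>_. 1"] assms
  by (simp add: laplacian_def[abs_def] real_polynomial_function_dirderiv)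

lemma real_polynomial_function_laplacian_iter:
  "real_polynomial_function \<phi> \<Longrightarrow> real_polynomial_function ((laplacian ^^ j) \<phi>)"
  by (induction j) (auto intro: real_polynomial_function_laplacian)

lemma laplacian_iter_lincomb:
  assumes "\<And>i. i \<in> I \<Longrightarrow> real_polynomial_function (\<phi> i)"
  shows "(laplacian ^^ j) (\<lambda>x. \<Sum>i\<in>I. c i * \<phi> i x) =
         (\<lambda>x. \<Sum>i\<in>I. c i * (laplacian ^^ j) (\<phi> i) x)"
  using assms
  by (induction j) (simp_all add: laplacian_lincomb real_polynomial_function_laplacian_iter)

section \<open>The Laplacian on products of powers of \<open>y \<bullet> y\<close> and
  \<open>x \<bullet> y\<close>\<close>

lemma real_polynomial_function_inner_powers:
  "real_polynomial_function (\<lambda>y::'a::euclidean_space. (y \<bullet> y) ^ j * (x \<bullet> y) ^ m)"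
proof -
  have 1: "real_polynomial_function (\<lambda>y. x \<bullet> y)" for x :: 'a
    by (intro real_polynomial_function.intros(1) bounded_linear_inner_right)
  have "real_polynomial_function (\<lambda>y::'a. \<Sum>b\<in>Basis. 1 * ((b \<bullet> y) * (b \<bullet> y)))"
    by (intro real_polynomial_function_lincomb real_polynomial_function.intros(4) 1)
  then have "real_polynomial_function (\<lambda>y::'a. y \<bullet> y)"
    by (subst euclidean_inner) (simp add: inner_commute)
  with 1 show ?thesis
    by (intro real_polynomial_function.intros(4) real_polynomial_function_power)
qed

lemma dirderiv_inner_powers:
  fixes x b :: "'a::euclidean_space"
  shows "dirderiv b (\<lambda>y. (y \<bullet> y) ^ j * (x \<bullet> y) ^ m) =
    (\<lambda>y. 2 * real j * (y \<bullet> b) * ((y \<bullet> y) ^ (j - 1) * (x \<bullet> y) ^ m)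
         + real m * (x \<bullet> b) * ((y \<bullet> y) ^ j * (x \<bullet> y) ^ (m - 1)))"
proof (intro ext dirderiv_eqI)
  fix y
  have 1: "((\<lambda>t. (y + t *\<^sub>R b) \<bullet> (y + t *\<^sub>R b)) has_field_derivative 2 * (y \<bullet> b)) (at 0)"
    by (auto simp: inner_add_left inner_add_right inner_commute intro!: derivative_eq_intros)
  have 2: "((\<lambda>t. x \<bullet> (y + t *\<^sub>R b)) has_field_derivative x \<bullet> b) (at 0)"
    by (auto simp: inner_add_right intro!: derivative_eq_intros)
  show "((\<lambda>t. ((y + t *\<^sub>R b) \<bullet> (y + t *\<^sub>R b)) ^ j * (x \<bullet> (y + t *\<^sub>R b)) ^ m) has_field_derivative
      2 * real j * (y \<bullet> b) * ((y \<bullet> y) ^ (j - 1) * (x \<bullet> y) ^ m)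
         + real m * (x \<bullet> b) * ((y \<bullet> y) ^ j * (x \<bullet> y) ^ (m - 1))) (at 0)"
    using DERIV_mult[OF DERIV_power[OF 1, of j] DERIV_power[OF 2, of m]]
    by (simp add: algebra_simps)
qed

text \<open>The span of these products is stable under the Laplacian, so harmonicity of a zonal
  function reduces to a recurrence between coefficients.\<close>

lemma laplacian_inner_powers:
  fixes x :: "'a::euclidean_space"
  shows "laplacian (\<lambda>y. (y \<bullet> y) ^ j * (x \<bullet> y) ^ m) =
    (\<lambda>y. 2 * real j * (real DIM('a) + 2 * real j - 2 + 2 * real m)
           * ((y \<bullet> y) ^ (j - 1) * (x \<bullet> y) ^ m)
       + real m * real (m - 1) * (x \<bullet> x) * ((y \<bullet> y) ^ j * (x \<bullet> y) ^ (m - 2)))"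
proof
  fix y
  define u where "u j m y = (y \<bullet> y) ^ j * (x \<bullet> y) ^ m" for j m y
  have d1: "dirderiv b (u j m) y = 2 * real j * (y \<bullet> b) * u (j - 1) m y
      + real m * (x \<bullet> b) * u j (m - 1) y" for b j m y
    unfolding u_def[abs_def] dirderiv_inner_powers ..
  have hu: "((\<lambda>t. u j m (y + t *\<^sub>R b)) has_field_derivative dirderiv b (u j m) y) (at 0)"
    for b j m y
    unfolding u_def[abs_def] by (intro has_dirderiv real_polynomial_function_inner_powers)
  have d2: "dirderiv b (dirderiv b (u j m)) y =
      2 * real j * ((b \<bullet> b) * u (j - 1) m y + (y \<bullet> b) * dirderiv b (u (j - 1) m) y)
      + real m * (x \<bullet> b) * dirderiv b (u j (m - 1)) y" for b
  proof (rule dirderiv_eqI)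
    have 1: "((\<lambda>t. (y + t *\<^sub>R b) \<bullet> b) has_field_derivative b \<bullet> b) (at 0)"
      by (auto simp: inner_add_left intro!: derivative_eq_intros)
    show "((\<lambda>t. dirderiv b (u j m) (y + t *\<^sub>R b)) has_field_derivative
      2 * real j * ((b \<bullet> b) * u (j - 1) m y + (y \<bullet> b) * dirderiv b (u (j - 1) m) y)
      + real m * (x \<bullet> b) * dirderiv b (u j (m - 1)) y) (at 0)"
      unfolding d1[of b j m]
      using DERIV_add[OF DERIV_cmult[OF DERIV_mult[OF 1 hu[of "j - 1" m y b]], of "2 * real j"]
             DERIV_cmult[OF hu[of j "m - 1" y b], of "real m * (x \<bullet> b)"]]
      by (simp add: algebra_simps)
  qed
  have B: "(\<Sum>b\<in>Basis. (v \<bullet> b) * (w \<bullet> b)) = v \<bullet> w" for v w :: 'a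
    by (rule euclidean_inner[symmetric])
  have "laplacian (u j m) y = (\<Sum>b\<in>Basis.
      2 * real j * (u (j - 1) m y
        + 2 * real (j - 1) * u (j - 2) m y * ((y \<bullet> b) * (y \<bullet> b))
        + real m * u (j - 1) (m - 1) y * ((x \<bullet> b) * (y \<bullet> b)))
      + real m * (2 * real j * u (j - 1) (m - 1) y * ((x \<bullet> b) * (y \<bullet> b))
        + real (m - 1) * u j (m - 2) y * ((x \<bullet> b) * (x \<bullet> b))))"
    unfolding laplacian_def
  proof (rule sum.cong)
    fix b :: 'a assume "b \<in> Basis"
    then have bb: "b \<bullet> b = 1" by simp
    have mm: "j - 1 - 1 = j - 2" "m - 1 - 1 = m - 2" by auto
    show "dirderiv b (dirderiv b (u j m)) y =
      2 * real j * (u (j - 1) m y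
        + 2 * real (j - 1) * u (j - 2) m y * ((y \<bullet> b) * (y \<bullet> b))
        + real m * u (j - 1) (m - 1) y * ((x \<bullet> b) * (y \<bullet> b)))
      + real m * (2 * real j * u (j - 1) (m - 1) y * ((x \<bullet> b) * (y \<bullet> b))
        + real (m - 1) * u j (m - 2) y * ((x \<bullet> b) * (x \<bullet> b)))"
      unfolding d2 d1 bb mm by (simp add: algebra_simps)
  qed simp
  also have "\<dots> = 2 * real j * (real DIM('a) * u (j - 1) m y
        + 2 * real (j - 1) * u (j - 2) m y * (y \<bullet> y)
        + real m * u (j - 1) (m - 1) y * (x \<bullet> y))
      + real m * (2 * real j * u (j - 1) (m - 1) y * (x \<bullet> y)
        + real (m - 1) * u j (m - 2) y * (x \<bullet> x))"
    by (simp add: sum.distrib B flip: sum_distrib_left)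
  also have "\<dots> = 2 * real j * (real DIM('a) + 2 * real j - 2 + 2 * real m) * u (j - 1) m y
       + real m * real (m - 1) * (x \<bullet> x) * u j (m - 2) y"
  proof -
    \<comment> \<open>Multiplication by \<open>y \<bullet> y\<close> restores the lowered power;
      where the exponent is truncated, the prefactor is 0.\<close>
    have 1: "real j * real (j - 1) * (u (j - 2) m y * (y \<bullet> y)) =
        real j * (real j - 1) * u (j - 1) m y"
      by (cases j; cases "j - 1") (auto simp: u_def)
    have 2: "real m * (u (j - 1) (m - 1) y * (x \<bullet> y)) = real m * u (j - 1) m y"
      by (cases m) (auto simp: u_def)
    have "2 * real j * (real DIM('a) * u (j - 1) m y
        + 2 * real (j - 1) * u (j - 2) m y * (y \<bullet> y)
        + real m * u (j - 1) (m - 1) y * (x \<bullet> y))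
      + real m * (2 * real j * u (j - 1) (m - 1) y * (x \<bullet> y)
        + real (m - 1) * u j (m - 2) y * (x \<bullet> x)) =
      2 * real j * real DIM('a) * u (j - 1) m y
        + 4 * (real j * real (j - 1) * (u (j - 2) m y * (y \<bullet> y)))
        + 4 * real j * (real m * (u (j - 1) (m - 1) y * (x \<bullet> y)))
        + real m * real (m - 1) * (x \<bullet> x) * u j (m - 2) y"
      by (simp add: algebra_simps)
    then show ?thesis unfolding 1 2 by (simp add: algebra_simps)
  qed
  finally show "laplacian (\<lambda>y. (y \<bullet> y) ^ j * (x \<bullet> y) ^ m) y =
    2 * real j * (real DIM('a) + 2 * real j - 2 + 2 * real m)
           * ((y \<bullet> y) ^ (j - 1) * (x \<bullet> y) ^ m)
       + real m * real (m - 1) * (x \<bullet> x) * ((y \<bullet> y) ^ j * (x \<bullet> y) ^ (m - 2))"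
    by (simp add: u_def[abs_def])
qed

section \<open>The zonal kernels as finite Gram kernels\<close>

text \<open>The coefficient of degree \<open>m\<close> in \<open>ultra_poly_ode\<close>; the
  right-hand factor comes from factoring
  \<open>n * (n + 2 * \<alpha> + 1) - m * (m + 2 * \<alpha> + 1)\<close>.\<close>

lemma coeff_ultra_poly_step:
  assumes "Suc (Suc m) \<le> n"
  shows "real (Suc (Suc m)) * real (Suc m) * coeff (ultra_poly n \<alpha>) (Suc (Suc m)) =
         - (real (n - m) * (real n + real m + 2 * \<alpha> + 1) * coeff (ultra_poly n \<alpha>) m)"
proof -
  let ?p = "ultra_poly n \<alpha>"
  have "coeff ([:1, 0, - 1:] * pderiv (pderiv ?p)
     - smult (2 * (\<alpha> + 1)) ([:0, 1:] * pderiv ?p)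
     + smult (real n * (real n + 2 * \<alpha> + 1)) ?p) m = 0"
    by (simp only: ultra_poly_ode coeff_0)
  moreover have "coeff ([:1, 0, - 1:] * pderiv (pderiv ?p)) m =
      real (Suc (Suc m)) * real (Suc m) * coeff ?p (Suc (Suc m)) - real m * (real m - 1) * coeff ?p m"
    by (cases m; cases "m - 1") (auto simp: coeff_pderiv algebra_simps)
  moreover have "coeff ([:0, 1:] * pderiv ?p) m = real m * coeff ?p m"
    by (cases m) (auto simp: coeff_pderiv)
  ultimately have "real (Suc (Suc m)) * real (Suc m) * coeff ?p (Suc (Suc m))
      = (real m * (real m - 1) + 2 * (\<alpha> + 1) * real m - real n * (real n + 2 * \<alpha> + 1)) * coeff ?p m"
    unfolding coeff_add coeff_diff coeff_smult by (simp add: algebra_simps)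
  then show ?thesis
    using assms by (simp add: of_nat_diff algebra_simps)
qed

text \<open>The homogenization of the ultraspherical polynomial evaluated at \<open>x \<bullet> y\<close>: of degree \<open>n\<close> in \<open>x\<close> and in \<open>y\<close>.\<close>

definition zonal :: "nat \<Rightarrow> real \<Rightarrow> 'a::euclidean_space \<Rightarrow> 'a \<Rightarrow> real" where
  "zonal n \<alpha> x y = (\<Sum>j\<le>n div 2. coeff (ultra_poly n \<alpha>) (n - 2 * j) * (x \<bullet> x) ^ j
                       * ((y \<bullet> y) ^ j * (x \<bullet> y) ^ (n - 2 * j)))"

lemma zonal_commute: "zonal n \<alpha> x y = zonal n \<alpha> y x"
  by (simp add: zonal_def inner_commute mult_ac)

lemma sum_parity:
  fixes f :: "nat \<Rightarrow> real"
  assumes "\<And>m. odd (m + n) \<Longrightarrow> f m = 0"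
  shows "(\<Sum>m\<le>n. f m) = (\<Sum>j\<le>n div 2. f (n - 2 * j))"
proof -
  have "(\<Sum>m\<le>n. f m) = (\<Sum>m\<in>(\<lambda>j. n - 2 * j) ` {..n div 2}. f m)"
  proof (rule sum.mono_neutral_right)
    show "\<forall>m\<in>{..n} - (\<lambda>j. n - 2 * j) ` {..n div 2}. f m = 0"
    proof
      fix m assume m: "m \<in> {..n} - (\<lambda>j. n - 2 * j) ` {..n div 2}"
      have "odd (m + n)"
      proof
        assume "even (m + n)"
        then have "m = n - 2 * ((n - m) div 2)" "(n - m) div 2 \<le> n div 2"
          using m by auto
        with m show False by blast
      qed
      then show "f m = 0" by (rule assms)
    qed
  qed auto
  also have "\<dots> = (\<Sum>j\<le>n div 2. f (n - 2 * j))"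
    by (subst sum.reindex) (auto simp: inj_on_def)
  finally show ?thesis .
qed

lemma zonal_eq_jacobi_P:
  assumes "x \<bullet> x = 1" "y \<bullet> y = 1"
  shows "zonal n \<alpha> x y = jacobi_P n \<alpha> \<alpha> (x \<bullet> y)"
proof -
  have "jacobi_P n \<alpha> \<alpha> (x \<bullet> y) = (\<Sum>m\<le>n. coeff (ultra_poly n \<alpha>) m * (x \<bullet> y) ^ m)"
    unfolding poly_ultra_poly[symmetric] poly_altdef
    using degree_ultra_poly_le[of n \<alpha>]
    by (intro sum.mono_neutral_left) (auto simp: coeff_eq_0)
  also have "\<dots> = zonal n \<alpha> x y"
    unfolding zonal_def using assms coeff_ultra_poly_parity[of n \<alpha>]
    by (subst sum_parity) auto
  finally show ?thesis by simp
qed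

text \<open>In dimension \<open>2 * \<alpha> + 3\<close> the factors of
  \<open>laplacian_inner_powers\<close> match those of \<open>coeff_ultra_poly_step\<close>, so the
  two contributions to each monomial cancel.\<close>

lemma laplacian_zonal:
  fixes x :: "'a::euclidean_space"
  assumes "real DIM('a) = 2 * \<alpha> + 3"
  shows "laplacian (zonal n \<alpha> x) = (\<lambda>_. 0)"
proof
  fix y
  define h where "h = n div 2"
  define c where "c j = coeff (ultra_poly n \<alpha>) (n - 2 * j)" for j
  define F where "F j = c j * (x \<bullet> x) ^ j *
     (2 * real j * (real DIM('a) + 2 * real j - 2 + 2 * real (n - 2 * j))
           * ((y \<bullet> y) ^ (j - 1) * (x \<bullet> y) ^ (n - 2 * j)))" for j
  define G where "G j = c j * (x \<bullet> x) ^ j *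
     (real (n - 2 * j) * real (n - 2 * j - 1) * (x \<bullet> x)
       * ((y \<bullet> y) ^ j * (x \<bullet> y) ^ (n - 2 * j - 2)))" for j
  have "laplacian (zonal n \<alpha> x) y = (\<Sum>j\<le>h. F j + G j)"
    unfolding zonal_def[abs_def] F_def G_def c_def h_def
    by (subst laplacian_lincomb)
       (simp_all add: real_polynomial_function_inner_powers laplacian_inner_powers distrib_left)
  also have "\<dots> = (\<Sum>j\<le>h. F j) + (\<Sum>j\<le>h. G j)" by (rule sum.distrib)
  \<comment> \<open>\<open>F 0\<close> contains the factor 0, and after the shift
    \<open>F (Suc j)\<close> carries the same monomial as \<open>G j\<close>.\<close>
  also have "(\<Sum>j\<le>h. F j) = (\<Sum>j<h. F (Suc j))"
    by (simp add: sum.atMost_shift F_def)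
  also have "(\<Sum>j\<le>h. G j) = (\<Sum>j<h. G j)"
  proof -
    \<comment> \<open>In the last term at most one power of \<open>x \<bullet> y\<close> is left,
      and a second derivative annihilates it.\<close>
    have "n - 2 * h = 0 \<or> n - 2 * h = 1" by (auto simp: h_def)
    then have "G h = 0" by (auto simp: G_def)
    then show ?thesis by (simp flip: lessThan_Suc_atMost)
  qed
  also have "(\<Sum>j<h. F (Suc j)) + (\<Sum>j<h. G j) = (\<Sum>j<h. 0)"
    unfolding sum.distrib[symmetric]
  proof (rule sum.cong)
    fix j assume "j \<in> {..<h}"
    then have "Suc (Suc (2 * j)) \<le> n" by (auto simp: h_def)
    then obtain m where m: "n = Suc (Suc (m + 2 * j))"
      by (metis add.commute add_Suc_right le_Suc_ex)
    have s: "real (Suc (Suc m)) * real (Suc m) * c j =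
         - (real (Suc (Suc (2 * j))) * (2 * real m + 2 * real j + 2 * \<alpha> + 3) * c (Suc j))"
      using coeff_ultra_poly_step[of m n \<alpha>] by (simp add: c_def m algebra_simps)
    have "F (Suc j) + G j = (x \<bullet> x) ^ Suc j * (y \<bullet> y) ^ j * (x \<bullet> y) ^ m *
       (real (Suc (Suc m)) * real (Suc m) * c j
        + real (Suc (Suc (2 * j))) * (2 * real m + 2 * real j + 2 * \<alpha> + 3) * c (Suc j))"
      using assms by (simp add: F_def G_def m algebra_simps)
    also have "\<dots> = 0" unfolding s by simp
    finally show "F (Suc j) + G j = 0" .
  qed simp
  finally show "laplacian (zonal n \<alpha> x) y = 0" by simp
qed

text \<open>On homogeneous polynomials of degree \<open>n\<close> this is, up to a positive factor, the projection onto
  the harmonic ones. All that matters is that it is linear, sends \<open>y \<mapsto> (x \<bullet> y) ^ n\<close> to the zonal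
  kernel and multiplies that kernel by a positive number: applying it in both variables to the
  Gram kernel \<open>(x \<bullet> y) ^ n\<close> then yields a Gram form of the zonal kernel.\<close>

definition harmonic_proj :: "nat \<Rightarrow> real \<Rightarrow> ('a::euclidean_space \<Rightarrow> real) \<Rightarrow> 'a \<Rightarrow> real" where
  "harmonic_proj n \<alpha> \<phi> y = (\<Sum>j\<le>n div 2. coeff (ultra_poly n \<alpha>) (n - 2 * j)
       * (fact (n - 2 * j) / fact n) * (y \<bullet> y) ^ j * (laplacian ^^ j) \<phi> y)"

lemma harmonic_proj_lincomb:
  assumes "\<And>i. i \<in> I \<Longrightarrow> real_polynomial_function (\<phi> i)"
  shows "harmonic_proj n \<alpha> (\<lambda>x. \<Sum>i\<in>I. c i * \<phi> i x) y = (\<Sum>i\<in>I. c i * harmonic_proj n \<alpha> (\<phi> i) y)"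
proof -
  define k where "k j = coeff (ultra_poly n \<alpha>) (n - 2 * j) * (fact (n - 2 * j) / fact n) * (y \<bullet> y) ^ j"
    for j
  have "harmonic_proj n \<alpha> (\<lambda>x. \<Sum>i\<in>I. c i * \<phi> i x) y =
      (\<Sum>j\<le>n div 2. \<Sum>i\<in>I. c i * (k j * (laplacian ^^ j) (\<phi> i) y))"
    using assms unfolding harmonic_proj_def k_def[symmetric]
    by (simp add: laplacian_iter_lincomb sum_distrib_left mult.left_commute)
  also have "\<dots> = (\<Sum>i\<in>I. c i * harmonic_proj n \<alpha> (\<phi> i) y)"
    unfolding harmonic_proj_def k_def[symmetric] sum_distrib_left by (rule sum.swap)
  finally show ?thesis .
qed

lemma laplacian_cmult:
  "real_polynomial_function \<phi> \<Longrightarrow> laplacian (\<lambda>x. c * \<phi> x) = (\<lambda>x. c * laplacian \<phi> x)"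
  using laplacian_lincomb[of "{()}" "\<lambda>_. \<phi>" "\<lambda>_. c"] by simp

lemma laplacian_iter_inner_power:
  assumes "2 * j \<le> n"
  shows "(laplacian ^^ j) (\<lambda>y. (x \<bullet> y) ^ n) =
    (\<lambda>y. fact n / fact (n - 2 * j) * (x \<bullet> x) ^ j * (x \<bullet> y) ^ (n - 2 * j))"
  using assms
proof (induction j)
  case (Suc j)
  then obtain m where m: "n = Suc (Suc (m + 2 * j))"
    by (metis add.commute add_Suc_right le_Suc_ex mult_Suc_right numeral_2_eq_2 plus_nat.add_Suc
        add_2_eq_Suc)
  have P: "real_polynomial_function (\<lambda>y::'a. (x \<bullet> y) ^ k)" for k
    using real_polynomial_function_inner_powers[of 0 x k] by simp
  have L: "laplacian (\<lambda>y::'a. (x \<bullet> y) ^ k) = (\<lambda>y. real k * real (k - 1) * (x \<bullet> x) * (x \<bullet> y) ^ (k - 2))"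
    for k
    using laplacian_inner_powers[of 0 x k] by simp
  have nm: "n - 2 * j = Suc (Suc m)" "n - 2 * Suc j = m" using m by auto
  have f: "fact n / fact (Suc (Suc m)) * (real (Suc (Suc m)) * real (Suc m)) = (fact n / fact m :: real)"
    by (simp add: divide_simps)
  have "(laplacian ^^ Suc j) (\<lambda>y. (x \<bullet> y) ^ n) =
      laplacian (\<lambda>y. fact n / fact (Suc (Suc m)) * (x \<bullet> x) ^ j * (x \<bullet> y) ^ Suc (Suc m))"
    using Suc.prems Suc.IH[unfolded nm] by simp
  also have "\<dots> = (\<lambda>y. fact n / fact (Suc (Suc m)) * (real (Suc (Suc m)) * real (Suc m))
      * ((x \<bullet> x) ^ Suc j * (x \<bullet> y) ^ m))"
    by (simp only: laplacian_cmult[OF P] L) (simp add: mult_ac)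
  also have "\<dots> = (\<lambda>y. fact n / fact m * (x \<bullet> x) ^ Suc j * (x \<bullet> y) ^ m)"
    unfolding f by (simp only: mult.assoc)
  finally show ?case unfolding nm .
qed simp

text \<open>The factorials in \<open>harmonic_proj\<close> are chosen to cancel those that the
  iterated Laplacians produce.\<close>

lemma harmonic_proj_inner_power:
  "harmonic_proj n \<alpha> (\<lambda>y. (x \<bullet> y) ^ n) y = zonal n \<alpha> x y"
  unfolding harmonic_proj_def zonal_def
  by (intro sum.cong) (auto simp: laplacian_iter_inner_power)

lemma laplacian_iter_0: "(laplacian ^^ j) (\<lambda>_. 0) = (\<lambda>_. 0)"
  using laplacian_iter_lincomb[of "{}"] by simp

text \<open>The zonal function is harmonic, so only the term without a Laplacian survives.\<close>

lemma harmonic_proj_zonal: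
  fixes x :: "'a::euclidean_space"
  assumes "real DIM('a) = 2 * \<alpha> + 3"
  shows "harmonic_proj n \<alpha> (zonal n \<alpha> x) y = coeff (ultra_poly n \<alpha>) n * zonal n \<alpha> x y"
proof -
  have "(laplacian ^^ Suc j) (zonal n \<alpha> x) y = 0" for j
    using assms by (simp only: funpow_Suc_right o_def laplacian_zonal laplacian_iter_0)
  then show ?thesis
    unfolding harmonic_proj_def by (subst sum.atMost_shift) simp
qed

text \<open>Start from the Gram expansion \<open>power\<close>. Projecting in \<open>y\<close> gives
  the zonal kernel with one projected factor; projecting again in \<open>x\<close> multiplies the
  kernel by \<open>c\<close> and makes both factors equal functions. Since \<open>c > 0\<close>, a
  factor \<open>sqrt c\<close> can be moved into each.\<close>

lemma zonal_gram:
  fixes \<alpha> :: real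
  assumes "real DIM('a::euclidean_space) = 2 * \<alpha> + 3" "\<alpha> \<ge> 0"
  shows "\<exists>(I :: (nat \<Rightarrow> 'a) set) \<psi>. finite I \<and> (\<forall>x y :: 'a. zonal n \<alpha> x y = (\<Sum>i\<in>I. \<psi> i x * \<psi> i y))"
proof -
  \<comment> \<open>An index chooses one basis vector for each of the \<open>n\<close> factors of
    the power.\<close>
  define I where "I = (\<Pi>\<^sub>E k\<in>{..<n}. Basis :: 'a set)"
  define \<phi> where "\<phi> i x = (\<Prod>k<n. x \<bullet> i k)" for i :: "nat \<Rightarrow> 'a" and x
  define c where "c = coeff (ultra_poly n \<alpha>) n"
  have c: "c > 0" unfolding c_def using assms(2) by (rule coeff_ultra_poly_top_pos)
  have I: "finite I" by (auto simp: I_def intro!: finite_PiE)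
  have power: "(x \<bullet> y) ^ n = (\<Sum>i\<in>I. \<phi> i x * \<phi> i y)" for x y :: 'a
  proof -
    have "(x \<bullet> y) ^ n = (\<Prod>k<n. \<Sum>b\<in>Basis. (x \<bullet> b) * (y \<bullet> b))"
      by (simp add: euclidean_inner[of x y])
    also have "\<dots> = (\<Sum>i\<in>I. \<phi> i x * \<phi> i y)"
      unfolding I_def \<phi>_def by (subst prod_sum_PiE) (auto simp: prod.distrib)
    finally show ?thesis .
  qed
  have poly: "real_polynomial_function (\<phi> i)" for i
  proof -
    have "real_polynomial_function (\<lambda>x. \<Prod>k\<in>K. x \<bullet> i k)" for K :: "nat set"
      by (induction K rule: infinite_finite_induct)
         (auto intro!: real_polynomial_function.intros(2,4)
            real_polynomial_function.intros(1)[OF bounded_linear_inner_left])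
    then show ?thesis by (simp add: \<phi>_def[abs_def])
  qed
  have Z: "zonal n \<alpha> x y = (\<Sum>i\<in>I. \<phi> i x * harmonic_proj n \<alpha> (\<phi> i) y)" for x y
    unfolding harmonic_proj_inner_power[symmetric] power
    by (rule harmonic_proj_lincomb) (rule poly)
  have "zonal n \<alpha> x y = (1 / c) * (\<Sum>i\<in>I. harmonic_proj n \<alpha> (\<phi> i) x * harmonic_proj n \<alpha> (\<phi> i) y)" for x y
  proof -
    have "c * zonal n \<alpha> x y = harmonic_proj n \<alpha> (zonal n \<alpha> y) x"
      using harmonic_proj_zonal[OF assms(1), of n y x] by (simp add: c_def zonal_commute)
    also have "zonal n \<alpha> y = (\<lambda>x. \<Sum>i\<in>I. harmonic_proj n \<alpha> (\<phi> i) y * \<phi> i x)"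
      unfolding zonal_commute[of n \<alpha> y] by (simp add: Z mult.commute)
    also have "harmonic_proj n \<alpha> (\<lambda>x. \<Sum>i\<in>I. harmonic_proj n \<alpha> (\<phi> i) y * \<phi> i x) x
        = (\<Sum>i\<in>I. harmonic_proj n \<alpha> (\<phi> i) y * harmonic_proj n \<alpha> (\<phi> i) x)"
      by (rule harmonic_proj_lincomb) (rule poly)
    finally show ?thesis using c by (simp add: field_simps)
  qed
  then have "zonal n \<alpha> x y = (\<Sum>i\<in>I. (harmonic_proj n \<alpha> (\<phi> i) x / sqrt c)
      * (harmonic_proj n \<alpha> (\<phi> i) y / sqrt c))" for x y
    using c by (simp add: sum_divide_distrib)
  then show ?thesis using I
    by (intro exI[of _ I] exI[of _ "\<lambda>i x. harmonic_proj n \<alpha> (\<phi> i) x / sqrt c"]) simp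
qed

text \<open>Schur's product argument: the product of two finite Gram kernels is a Gram kernel
  indexed by pairs, so its form is a sum of squares.\<close>

lemma jacobi_P_product_form_nonneg:
  fixes x :: "nat \<Rightarrow> 'a::euclidean_space"
  assumes "real DIM('a) = 2 * \<alpha> + 3" "\<alpha> \<ge> 0" "\<And>i. i < N \<Longrightarrow> x i \<in> sphere 0 1"
  shows "(\<Sum>i<N. \<Sum>j<N. c i * c j * (jacobi_P k \<alpha> \<alpha> (x i \<bullet> x j) * jacobi_P l \<alpha> \<alpha> (x i \<bullet> x j))) \<ge> 0"
proof -
  obtain I :: "(nat \<Rightarrow> 'a) set" and \<phi> where I: "finite I"
      "\<And>x y :: 'a. zonal k \<alpha> x y = (\<Sum>i\<in>I. \<phi> i x * \<phi> i y)"
    using zonal_gram[OF assms(1,2)] by blast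
  obtain J :: "(nat \<Rightarrow> 'a) set" and \<psi> where J: "finite J"
      "\<And>x y :: 'a. zonal l \<alpha> x y = (\<Sum>i\<in>J. \<psi> i x * \<psi> i y)"
    using zonal_gram[OF assms(1,2)] by blast
  have unit: "x i \<bullet> x i = 1" if "i < N" for i
    using assms(3)[OF that] by (simp add: norm_eq_1)
  define T where "T r i = c i * (\<phi> (fst r) (x i) * \<psi> (snd r) (x i))" for r i
  have "(\<Sum>i<N. \<Sum>j<N. c i * c j * (jacobi_P k \<alpha> \<alpha> (x i \<bullet> x j) * jacobi_P l \<alpha> \<alpha> (x i \<bullet> x j)))
      = (\<Sum>i<N. \<Sum>j<N. \<Sum>r\<in>I \<times> J. T r i * T r j)"
  proof (intro sum.cong refl)
    fix i j assume "i \<in> {..<N}" "j \<in> {..<N}"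
    then have "c i * c j * (jacobi_P k \<alpha> \<alpha> (x i \<bullet> x j) * jacobi_P l \<alpha> \<alpha> (x i \<bullet> x j)) =
        c i * c j * (zonal k \<alpha> (x i) (x j) * zonal l \<alpha> (x i) (x j))"
      by (simp add: zonal_eq_jacobi_P unit)
    also have "\<dots> = c i * c j * (\<Sum>r\<in>I \<times> J. \<phi> (fst r) (x i) * \<phi> (fst r) (x j)
        * (\<psi> (snd r) (x i) * \<psi> (snd r) (x j)))"
      unfolding I(2) J(2) sum_product by (simp add: sum.cartesian_product case_prod_beta)
    also have "\<dots> = (\<Sum>r\<in>I \<times> J. T r i * T r j)"
      unfolding sum_distrib_left T_def by (intro sum.cong refl) (simp only: mult_ac)
    finally show "c i * c j * (jacobi_P k \<alpha> \<alpha> (x i \<bullet> x j) * jacobi_P l \<alpha> \<alpha> (x i \<bullet> x j)) = \<dots>" .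
  qed
  also have "\<dots> = (\<Sum>i<N. \<Sum>r\<in>I \<times> J. \<Sum>j<N. T r i * T r j)"
    by (intro sum.cong refl sum.swap)
  also have "\<dots> = (\<Sum>r\<in>I \<times> J. \<Sum>i<N. \<Sum>j<N. T r i * T r j)"
    by (rule sum.swap)
  also have "\<dots> = (\<Sum>r\<in>I \<times> J. (\<Sum>i<N. T r i)\<^sup>2)"
    unfolding power2_eq_square sum_product ..
  also have "\<dots> \<ge> 0" by (intro sum_nonneg) auto
  finally show ?thesis .
qed

section \<open>Sums over regular polygons\<close>

text \<open>The sign is absorbed as \<open>cis (real j * pi)\<close>, which leaves a geometric sum
  whose ratio \<open>\<rho>\<close> satisfies \<open>\<rho> ^ (2 * q) = 1\<close>. The divisibility
  hypothesis says that \<open>\<rho>\<close> is not 1.\<close>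

lemma alternating_cis_sum:
  fixes m :: int
  assumes "q > 0" "\<not> 2 * int q dvd m + int q"
  shows "(\<Sum>j<2 * q. (- 1) ^ j * cis (m * (\<theta> - pi * real j / real q))) = 0"
proof -
  define \<rho> where "\<rho> = cis (pi * (real q - m) / real q)"
  have summand: "(- 1) ^ j * cis (m * (\<theta> - pi * real j / real q)) = cis (m * \<theta>) * \<rho> ^ j" for j
  proof -
    have "(- 1) ^ j = cis (real j * pi)"
      by (simp only: Complex.DeMoivre[symmetric] cis_pi)
    then have "(- 1) ^ j * cis (m * (\<theta> - pi * real j / real q))
        = cis (real j * pi + m * (\<theta> - pi * real j / real q))"
      by (simp add: cis_mult)
    also have "real j * pi + m * (\<theta> - pi * real j / real q)
        = m * \<theta> + real j * (pi * (real q - m) / real q)"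
      using assms(1) by (simp add: field_simps)
    finally show ?thesis by (simp add: cis_mult[symmetric] \<rho>_def Complex.DeMoivre)
  qed
  have "\<rho> \<noteq> 1"
  proof
    assume "\<rho> = 1"
    then have "cos (pi * (real q - m) / real q) = 1"
      unfolding \<rho>_def by (metis cis.sel(1) one_complex.sel(1))
    then obtain n :: int where "pi * (real q - m) / real q = real_of_int n * 2 * pi"
      unfolding cos_one_2pi_int by blast
    then have "pi * (real q - m) = pi * (2 * real_of_int n * real q)"
      using assms(1) by (simp add: field_simps)
    then have "real q - m = 2 * real_of_int n * real q"
      by (simp only: mult_left_cancel[OF pi_neq_zero])
    then have "real_of_int (m + int q) = real_of_int (2 * int q * (1 - n))"
      by (simp add: algebra_simps)
    then have "m + int q = 2 * int q * (1 - n)" by (simp only: of_int_eq_iff)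
    then show False using assms(2) by simp
  qed
  moreover have "\<rho> ^ (2 * q) = 1"
  proof -
    have "real (2 * q) * (pi * (real q - m) / real q) = 2 * pi * of_int (int q - m)"
      using assms(1) by (simp add: field_simps)
    then have "\<rho> ^ (2 * q) = cis (2 * pi * of_int (int q - m))"
      unfolding \<rho>_def Complex.DeMoivre by (rule arg_cong)
    also have "\<dots> = 1"
      by (rule cis_multiple_2pi) simp
    finally show ?thesis .
  qed
  ultimately have "(\<Sum>j<2 * q. \<rho> ^ j) = 0"
    by (simp add: geometric_sum)
  then show ?thesis
    unfolding summand by (simp flip: sum_distrib_left)
qed

text \<open>The power of the cosine contains only frequencies \<open>2 * i - e\<close> with
  \<open>i \<le> e\<close>, and none of them is resonant with the alternating signs.\<close>

lemma alternating_cos_power_sum: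
  assumes "q > 0" "e < q \<or> odd (e + q)"
  shows "(\<Sum>j<2 * q. (- 1) ^ j * cos (\<theta> - pi * real j / real q) ^ e) = 0"
proof -
  have cos: "complex_of_real (cos x ^ e) =
      (\<Sum>i\<le>e. of_nat (e choose i) / 2 ^ e * cis ((2 * int i - int e) * x))" for x :: real
  proof -
    have "complex_of_real (cos x) = (cis x + cis (- x)) / 2"
      by (simp add: complex_eq_iff)
    then have "complex_of_real (cos x ^ e) = (cis x + cis (- x)) ^ e / 2 ^ e"
      by (simp only: of_real_power power_divide)
    also have "\<dots> = (\<Sum>i\<le>e. of_nat (e choose i) / 2 ^ e * cis ((2 * int i - int e) * x))"
      unfolding binomial_ring sum_divide_distrib
    proof (intro sum.cong refl)
      fix i assume "i \<in> {..e}"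
      then have "cis x ^ i * cis (- x) ^ (e - i) = cis ((2 * int i - int e) * x)"
        by (simp only: Complex.DeMoivre cis_mult) (simp add: of_nat_diff algebra_simps)
      then show "of_nat (e choose i) * cis x ^ i * cis (- x) ^ (e - i) / 2 ^ e =
          of_nat (e choose i) / 2 ^ e * cis ((2 * int i - int e) * x)"
        by (simp add: mult.assoc)
    qed
    finally show ?thesis .
  qed
  have "complex_of_real (\<Sum>j<2 * q. (- 1) ^ j * cos (\<theta> - pi * real j / real q) ^ e) =
      (\<Sum>j<2 * q. \<Sum>i\<le>e. of_nat (e choose i) / 2 ^ e *
         ((- 1) ^ j * cis ((2 * int i - int e) * (\<theta> - pi * real j / real q))))"
    unfolding of_real_sum of_real_mult cos sum_distrib_left by (simp add: mult_ac)
  also have "\<dots> = (\<Sum>i\<le>e. of_nat (e choose i) / 2 ^ e *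
      (\<Sum>j<2 * q. (- 1) ^ j * cis ((2 * int i - int e) * (\<theta> - pi * real j / real q))))"
    unfolding sum_distrib_left by (rule sum.swap)
  also have "\<dots> = 0"
  proof (intro sum.neutral ballI)
    fix i assume i: "i \<in> {..e}"
    have "\<not> 2 * int q dvd (2 * int i - int e) + int q"
    proof
      assume "2 * int q dvd (2 * int i - int e) + int q"
      then obtain n where n: "(2 * int i - int e) + int q = 2 * int q * n" by (elim dvdE)
      \<comment> \<open>Divisibility forces this parity, which leaves the case \<open>e < q\<close>;
        there the multiple of \<open>2 * q\<close> would lie strictly between 0 and
        \<open>2 * q\<close>.\<close>
      have "even (e + q)"
      proof -
        have "even ((2 * int i - int e) + int q)" unfolding n by simp
        then show ?thesis by simp
      qed
      then have "e < q" using assms(2) by blast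
      then have "0 < 2 * int q * n" "2 * int q * n < 2 * int q"
        using i unfolding n[symmetric] by auto
      then have "0 < n" "n < 1"
        using assms(1) by (auto simp: zero_less_mult_iff mult_less_cancel_left1)
      then show False by simp
    qed
    from alternating_cis_sum[OF assms(1) this, of \<theta>]
    show "of_nat (e choose i) / 2 ^ e *
      (\<Sum>j<2 * q. (- 1) ^ j * cis ((2 * int i - int e) * (\<theta> - pi * real j / real q))) = 0"
      by simp
  qed
  finally show ?thesis by (simp only: of_real_eq_0_iff)
qed

text \<open>The product polynomial contains only powers of degree at most \<open>k + l\<close> and
  of the parity of \<open>k + l\<close>, so the hypothesis passes to each of them.\<close>

lemma alternating_jacobi_P_sum:
  assumes "q > 0" "k + l < q \<or> odd (k + l + q)"
  shows "(\<Sum>j<2 * q. (- 1) ^ j * (jacobi_P k \<alpha> \<alpha> (cos (\<theta> - pi * real j / real q)) *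
            jacobi_P l \<alpha> \<alpha> (cos (\<theta> - pi * real j / real q)))) = 0"
proof -
  define h where "h = ultra_poly k \<alpha> * ultra_poly l \<alpha>"
  have h: "jacobi_P k \<alpha> \<alpha> t * jacobi_P l \<alpha> \<alpha> t = (\<Sum>e\<le>degree h. coeff h e * t ^ e)" for t
    by (simp add: h_def poly_ultra_poly[symmetric] flip: poly_altdef)
  have "(\<Sum>j<2 * q. (- 1) ^ j * (jacobi_P k \<alpha> \<alpha> (cos (\<theta> - pi * real j / real q)) *
            jacobi_P l \<alpha> \<alpha> (cos (\<theta> - pi * real j / real q)))) =
     (\<Sum>j<2 * q. \<Sum>e\<le>degree h. coeff h e * ((- 1) ^ j * cos (\<theta> - pi * real j / real q) ^ e))"
    unfolding h sum_distrib_left by (simp add: mult_ac)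
  also have "\<dots> = (\<Sum>e\<le>degree h. coeff h e *
       (\<Sum>j<2 * q. (- 1) ^ j * cos (\<theta> - pi * real j / real q) ^ e))"
    unfolding sum_distrib_left by (rule sum.swap)
  also have "\<dots> = 0"
  proof (intro sum.neutral ballI)
    fix e assume e: "e \<in> {..degree h}"
    show "coeff h e * (\<Sum>j<2 * q. (- 1) ^ j * cos (\<theta> - pi * real j / real q) ^ e) = 0"
    proof (cases "coeff h e = 0")
      case False
      then obtain i where i: "i \<le> e" "coeff (ultra_poly k \<alpha>) i \<noteq> 0" "coeff (ultra_poly l \<alpha>) (e - i) \<noteq> 0"
        unfolding h_def coeff_mult by (metis (no_types, lifting) atMost_iff mult_eq_0_iff sum.neutral)
      then have "even (i + k)" "even (e - i + l)" by (auto dest: coeff_ultra_poly_parity)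
      then have "even (e + (k + l))" using i(1) by auto
      moreover have "i \<le> k" "e - i \<le> l"
        using i le_degree degree_ultra_poly_le order_trans by metis+
      then have "e \<le> k + l" by simp
      ultimately have "e < q \<or> odd (e + q)" using assms(2) by auto
      then show ?thesis using alternating_cos_power_sum[OF assms(1)] by simp
    qed simp
  qed
  finally show ?thesis .
qed

section \<open>Quadratic forms of the product kernel\<close>

text \<open>Pointwise convergence suffices because the form is a finite sum. The arbitrary weights
  \<open>w\<close> allow the other factor of a product kernel to be absorbed into them.\<close>

lemma schoenberg_series_form_sums:
  assumes "schoenberg_series d f a" "\<And>i j. i < N \<Longrightarrow> j < N \<Longrightarrow> t i j \<in> {-1..1}"
  shows "(\<lambda>k. a k * (\<Sum>i<N. \<Sum>j<N. w i j * jacobi_P k ((real d - 2) / 2) ((real d - 2) / 2) (t i j)))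
    sums (\<Sum>i<N. \<Sum>j<N. w i j * f (t i j))"
proof -
  have "(\<lambda>k. \<Sum>i<N. \<Sum>j<N. w i j * (a k * jacobi_P k ((real d - 2) / 2) ((real d - 2) / 2) (t i j)))
    sums (\<Sum>i<N. \<Sum>j<N. w i j * f (t i j))"
    using assms by (intro sums_sum sums_mult) (auto simp: schoenberg_series_def)
  then show ?thesis by (simp add: sum_distrib_left mult.left_commute)
qed

lemma sphere_inner_bounds:
  fixes x y :: "'a::real_inner"
  assumes "x \<in> sphere 0 1" "y \<in> sphere 0 1"
  shows "x \<bullet> y \<in> {-1..1}"
  using assms Cauchy_Schwarz_ineq2[of x y] by (simp add: abs_le_iff)

lemma sphere_inner_eq_1_iff:
  fixes x y :: "'a::real_inner"
  assumes "x \<in> sphere 0 1" "y \<in> sphere 0 1"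
  shows "x \<bullet> y = 1 \<longleftrightarrow> x = y"
proof -
  have "x \<bullet> x = 1" "y \<bullet> y = 1" using assms by (auto simp: norm_eq_1)
  then have "(x - y) \<bullet> (x - y) = 2 - 2 * (x \<bullet> y)"
    by (simp add: inner_diff_left inner_diff_right inner_commute)
  then show ?thesis using inner_eq_zero_iff[of "x - y"] \<open>x \<bullet> x = 1\<close> by auto
qed

text \<open>One of the two indices is at least half of \<open>m\<close>, possibly a different one
  for each \<open>m\<close>; its factor is small and the other is bounded by 1.\<close>

lemma ultra_normed_product_tendsto_0:
  assumes "\<alpha> \<ge> 0" "\<bar>t\<bar> < 1" "\<And>m :: nat. k m + l m \<ge> m"
  shows "(\<lambda>m. ultra_normed (k m) \<alpha> t * ultra_normed (l m) \<alpha> t) \<longlonglongrightarrow> 0"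
proof (rule LIMSEQ_I)
  fix r :: real assume "r > 0"
  obtain M where M: "\<And>n. n \<ge> M \<Longrightarrow> \<bar>ultra_normed n \<alpha> t\<bar> < r"
    using LIMSEQ_D[OF ultra_normed_tendsto_0[OF assms(1,2)] \<open>r > 0\<close>] by auto
  have le1: "\<bar>ultra_normed n \<alpha> t\<bar> \<le> 1" for n
    using assms by (intro abs_ultra_normed_le) auto
  have "\<bar>ultra_normed (k m) \<alpha> t * ultra_normed (l m) \<alpha> t\<bar> < r" if "m \<ge> 2 * M" for m
  proof -
    have "k m \<ge> M \<or> l m \<ge> M" using assms(3)[of m] that by linarith
    then show ?thesis
    proof
      assume "k m \<ge> M"
      then show ?thesis
        using M[of "k m"] mult_left_mono[OF le1[of "l m"], of "\<bar>ultra_normed (k m) \<alpha> t\<bar>"]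
        by (simp add: abs_mult)
    next
      assume "l m \<ge> M"
      then show ?thesis
        using M[of "l m"] mult_right_mono[OF le1[of "k m"], of "\<bar>ultra_normed (l m) \<alpha> t\<bar>"]
        by (simp add: abs_mult)
    qed
  qed
  then show "\<exists>no. \<forall>m\<ge>no. norm (ultra_normed (k m) \<alpha> t * ultra_normed (l m) \<alpha> t - 0) < r"
    by auto
qed

text \<open>As \<open>k + l\<close> tends to infinity with fixed parity, the normalized products \<open>P\<^sub>k P\<^sub>l\<close> converge to 1 at 1, to
  \<open>\<sigma>\<close> at -1 and to 0 in between.\<close>

lemma limit_form_eq_0:
  fixes A :: "(nat \<times> nat) set"
  assumes "\<alpha> \<ge> 0" "\<And>i j. i < N \<Longrightarrow> j < N \<Longrightarrow> t i j \<in> {-1..1}"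
    and zero: "\<And>k l. (k, l) \<in> A \<Longrightarrow>
      (\<Sum>i<N. \<Sum>j<N. w i j * (jacobi_P k \<alpha> \<alpha> (t i j) * jacobi_P l \<alpha> \<alpha> (t i j))) = 0"
    and inf: "\<And>m. \<exists>k l. (k, l) \<in> A \<and> (- 1) ^ (k + l) = \<sigma> \<and> k + l \<ge> m"
  shows "(\<Sum>i<N. \<Sum>j<N. w i j * (if t i j = 1 then 1 else if t i j = - 1 then \<sigma> else 0)) = (0 :: real)"
proof -
  obtain k l where kl: "\<And>m. (k m, l m) \<in> A" "\<And>m. (- 1) ^ (k m + l m) = \<sigma>" "\<And>m. k m + l m \<ge> m"
    using inf by metis
  define R where "R m t = ultra_normed (k m) \<alpha> t * ultra_normed (l m) \<alpha> t" for m t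
  have lim: "(\<lambda>m. R m s) \<longlonglongrightarrow> (if s = 1 then 1 else if s = - 1 then \<sigma> else 0)"
    if "s \<in> {-1..1}" for s
  proof -
    have "s = 1 \<or> s = - 1 \<or> \<bar>s\<bar> < 1" using that unfolding atLeastAtMost_iff by linarith
    then consider "s = 1" | "s = - 1" | "\<bar>s\<bar> < 1" by blast
    then show ?thesis
    proof cases
      case 1
      then show ?thesis by (simp add: R_def ultra_normed_one assms(1))
    next
      case 2
      have "R m (- 1) = \<sigma>" for m
        using ultra_normed_minus[of _ \<alpha> 1] kl(2)[of m]
        by (simp add: R_def ultra_normed_one assms(1) power_add)
      with 2 show ?thesis by simp
    next
      case 3
      then show ?thesis
        using ultra_normed_product_tendsto_0[OF assms(1) 3 kl(3)] by (auto simp: R_def)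
    qed
  qed
  have "(\<lambda>m. \<Sum>i<N. \<Sum>j<N. w i j * R m (t i j)) \<longlonglongrightarrow>
      (\<Sum>i<N. \<Sum>j<N. w i j * (if t i j = 1 then 1 else if t i j = - 1 then \<sigma> else 0))"
    using assms(2) by (intro tendsto_intros lim) auto
  moreover have "(\<Sum>i<N. \<Sum>j<N. w i j * R m (t i j)) = 0" for m
  proof -
    \<comment> \<open>Normalization divides the whole form by one constant, so its vanishing
      persists.\<close>
    have "(\<Sum>i<N. \<Sum>j<N. w i j * R m (t i j)) =
        (\<Sum>i<N. \<Sum>j<N. w i j * (jacobi_P (k m) \<alpha> \<alpha> (t i j) * jacobi_P (l m) \<alpha> \<alpha> (t i j)))
          / (jacobi_P (k m) \<alpha> \<alpha> 1 * jacobi_P (l m) \<alpha> \<alpha> 1)"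
      by (simp add: R_def ultra_normed_def sum_divide_distrib)
    then show ?thesis using zero[OF kl(1)] by simp
  qed
  ultimately show ?thesis by (simp add: LIMSEQ_const_iff)
qed

lemma isotropic_kernel_sphere:
  assumes "x \<in> sphere 0 1" "y \<in> sphere 0 1"
  shows "isotropic_kernel f x y = f (x \<bullet> y)"
  using assms by (simp only: isotropic_kernel_def cos_geodesic_dist)

section \<open>Zeros and positivity of the form of a product of two Schoenberg series\<close>

context
  fixes d :: nat and f g :: "real \<Rightarrow> real" and a b :: "nat \<Rightarrow> real"
  assumes d: "d \<ge> 2" and f: "schoenberg_series d f a" and g: "schoenberg_series d g b"
begin

abbreviation (input) P :: "nat \<Rightarrow> real \<Rightarrow> real" where
  "P k \<equiv> jacobi_P k ((real d - 2) / 2) ((real d - 2) / 2)"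

lemma coeffs_nonneg: "a k \<ge> 0" "b k \<ge> 0"
  using f g by (auto simp: schoenberg_series_def)

text \<open>First \<open>f\<close> is expanded with \<open>g\<close> in the weights, then
  \<open>g\<close> with \<open>P k\<close> in the weights; every term of the iterated series is
  0.\<close>

lemma product_form_vanishes:
  assumes t: "\<And>i j. i < N \<Longrightarrow> j < N \<Longrightarrow> t i j \<in> {-1..1}"
    and "\<And>k l. a k * b l > 0 \<Longrightarrow> (\<Sum>i<N. \<Sum>j<N. w i j * (P k (t i j) * P l (t i j))) = 0"
  shows "(\<Sum>i<N. \<Sum>j<N. w i j * (f (t i j) * g (t i j))) = 0"
proof -
  have "(\<lambda>k. a k * (\<Sum>i<N. \<Sum>j<N. w i j * g (t i j) * P k (t i j)))
      sums (\<Sum>i<N. \<Sum>j<N. w i j * g (t i j) * f (t i j))"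
    by (rule schoenberg_series_form_sums[OF f t])
  moreover have "a k * (\<Sum>i<N. \<Sum>j<N. w i j * g (t i j) * P k (t i j)) = 0" for k
  proof (cases "a k = 0")
    case False
    then have "a k > 0" using coeffs_nonneg(1)[of k] by simp
    have "(\<lambda>l. b l * (\<Sum>i<N. \<Sum>j<N. w i j * P k (t i j) * P l (t i j)))
        sums (\<Sum>i<N. \<Sum>j<N. w i j * P k (t i j) * g (t i j))"
      by (rule schoenberg_series_form_sums[OF g t])
    moreover have "b l * (\<Sum>i<N. \<Sum>j<N. w i j * P k (t i j) * P l (t i j)) = 0" for l
      using assms(2)[of k l] coeffs_nonneg(2)[of l] \<open>a k > 0\<close>
      by (cases "b l = 0") (auto simp: mult.assoc)
    ultimately have "(\<Sum>i<N. \<Sum>j<N. w i j * P k (t i j) * g (t i j)) = 0"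
      using sums_unique2[OF _ sums_zero] by simp
    then show ?thesis by (simp add: mult_ac)
  qed simp
  ultimately have "(\<Sum>i<N. \<Sum>j<N. w i j * g (t i j) * f (t i j)) = 0"
    using sums_unique2[OF _ sums_zero] by simp
  then show ?thesis by (simp add: mult_ac)
qed

text \<open>The terms are nonnegative at both levels: \<open>Q\<close> makes the inner sums
  \<open>G\<close> nonnegative, and these make \<open>H\<close> nonnegative. A series of nonnegative
  terms with sum 0 has only zero terms; used for the outer and then the inner series, this gives the
  second claim.\<close>

lemma product_form_nonneg:
  fixes x :: "nat \<Rightarrow> 'a::euclidean_space"
  assumes "DIM('a) = d + 1" and x: "\<And>i. i < N \<Longrightarrow> x i \<in> sphere 0 1"
  shows "(\<Sum>i<N. \<Sum>j<N. c i * c j * (f (x i \<bullet> x j) * g (x i \<bullet> x j))) \<ge> 0"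
    and "(\<Sum>i<N. \<Sum>j<N. c i * c j * (f (x i \<bullet> x j) * g (x i \<bullet> x j))) = 0 \<Longrightarrow> a k * b l > 0 \<Longrightarrow>
      (\<Sum>i<N. \<Sum>j<N. c i * c j * (P k (x i \<bullet> x j) * P l (x i \<bullet> x j))) = 0"
proof -
  define Q where "Q k l = (\<Sum>i<N. \<Sum>j<N. c i * c j * (P k (x i \<bullet> x j) * P l (x i \<bullet> x j)))" for k l
  define G where "G k = (\<Sum>i<N. \<Sum>j<N. c i * c j * (P k (x i \<bullet> x j) * g (x i \<bullet> x j)))" for k
  define H where "H = (\<Sum>i<N. \<Sum>j<N. c i * c j * (f (x i \<bullet> x j) * g (x i \<bullet> x j)))"
  have t: "x i \<bullet> x j \<in> {-1..1}" if "i < N" "j < N" for i j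
    using that by (intro sphere_inner_bounds x)
  have Q: "Q k l \<ge> 0" for k l
    unfolding Q_def using assms d
    by (intro jacobi_P_product_form_nonneg) (auto simp: field_simps)
  have G: "(\<lambda>l. b l * Q k l) sums G k" for k
    using schoenberg_series_form_sums[OF g, where N = N and t = "\<lambda>i j. x i \<bullet> x j" and w = "\<lambda>i j. c i * c j * P k (x i \<bullet> x j)", OF t]
    by (simp add: Q_def G_def mult_ac)
  have G_nonneg: "G k \<ge> 0" for k
    using sums_le[OF _ sums_zero G] Q coeffs_nonneg by simp
  have H: "(\<lambda>k. a k * G k) sums H"
    using schoenberg_series_form_sums[OF f, where N = N and t = "\<lambda>i j. x i \<bullet> x j" and w = "\<lambda>i j. c i * c j * g (x i \<bullet> x j)", OF t]
    by (simp add: H_def G_def mult_ac)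
  show "H \<ge> 0"
    using sums_le[OF _ sums_zero H] G_nonneg coeffs_nonneg by simp
  show "Q k l = 0" if "H = 0" "a k * b l > 0"
  proof -
    have "a k > 0" "b l > 0"
      using that(2) coeffs_nonneg[of k] coeffs_nonneg[of l] by (auto simp: zero_less_mult_iff)
    have "\<forall>k. a k * G k = 0"
      using H that(1) G_nonneg coeffs_nonneg by (subst suminf_eq_zero_iff[symmetric]) (auto simp: sums_iff)
    then have "G k = 0" using \<open>a k > 0\<close> by (metis mult_eq_0_iff less_irrefl)
    then have "\<forall>l. b l * Q k l = 0"
      using G[of k] Q coeffs_nonneg by (subst suminf_eq_zero_iff[symmetric]) (auto simp: sums_iff)
    then show ?thesis using \<open>b l > 0\<close> by (metis mult_eq_0_iff less_irrefl)
  qed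
qed

text \<open>Were the form 0 for a nonzero \<open>c\<close>, all forms of \<open>P k * P l\<close>
  with positive weight would vanish, and \<open>limit_form_eq_0\<close> would apply once along even
  and once along odd \<open>k + l\<close>.\<close>

lemma strictly_pos_def_product:
  assumes "DIM('a::euclidean_space) = d + 1"
    and even: "\<And>m. \<exists>k l. a k * b l > 0 \<and> even (k + l) \<and> k + l \<ge> m"
    and odd: "\<And>m. \<exists>k l. a k * b l > 0 \<and> odd (k + l) \<and> k + l \<ge> m"
  shows "strictly_pos_def_kernel_on (sphere (0 :: 'a) 1) (isotropic_kernel (\<lambda>t. f t * g t))"
proof -
  have kernel: "(\<Sum>i<N. \<Sum>j<N. c i * c j * isotropic_kernel (\<lambda>t. f t * g t) (x i) (x j)) =
      (\<Sum>i<N. \<Sum>j<N. c i * c j * (f (x i \<bullet> x j) * g (x i \<bullet> x j)))"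
    if "\<forall>i<N. x i \<in> sphere (0 :: 'a) 1" for N :: nat and x :: "nat \<Rightarrow> 'a" and c :: "nat \<Rightarrow> real"
    using that by (intro sum.cong refl) (simp add: isotropic_kernel_sphere del: mem_sphere_0)
  have "(\<Sum>i<N. \<Sum>j<N. c i * c j * (f (x i \<bullet> x j) * g (x i \<bullet> x j))) \<noteq> 0"
    if x: "\<forall>i<N. x i \<in> sphere (0 :: 'a) 1" and inj: "inj_on x {..<N}" and c: "\<exists>i<N. c i \<noteq> 0" for N :: nat and x :: "nat \<Rightarrow> 'a" and c :: "nat \<Rightarrow> real"
  proof
    assume "(\<Sum>i<N. \<Sum>j<N. c i * c j * (f (x i \<bullet> x j) * g (x i \<bullet> x j))) = 0"
    then have zero: "(\<Sum>i<N. \<Sum>j<N. c i * c j * (P k (x i \<bullet> x j) * P l (x i \<bullet> x j))) = 0"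
      if "(k, l) \<in> {(k, l). a k * b l > 0}" for k l
      using product_form_nonneg(2)[OF assms(1), of N x c k l] x that by blast
    have t: "x i \<bullet> x j \<in> {-1..1}" if "i < N" "j < N" for i j
      using that x by (intro sphere_inner_bounds) auto
    have \<alpha>: "(real d - 2) / 2 \<ge> 0" using d by simp
    have "(\<Sum>i<N. \<Sum>j<N. c i * c j * (if x i \<bullet> x j = 1 then 1 else if x i \<bullet> x j = - 1 then 1 else 0)) = 0"
    proof (rule limit_form_eq_0[OF \<alpha> t zero])
      show "\<exists>k l. (k, l) \<in> {(k, l). a k * b l > 0} \<and> (- 1 :: real) ^ (k + l) = 1 \<and> k + l \<ge> m" for m
      proof -
        obtain k l where "a k * b l > 0" "even (k + l)" "k + l \<ge> m" using even[of m] by blast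
        then show ?thesis using neg_one_even_power[of "k + l", where 'a = real] by blast
      qed
    qed
    moreover have "(\<Sum>i<N. \<Sum>j<N. c i * c j * (if x i \<bullet> x j = 1 then 1 else if x i \<bullet> x j = - 1 then - 1 else 0)) = 0"
    proof (rule limit_form_eq_0[OF \<alpha> t zero])
      show "\<exists>k l. (k, l) \<in> {(k, l). a k * b l > 0} \<and> (- 1 :: real) ^ (k + l) = - 1 \<and> k + l \<ge> m" for m
      proof -
        obtain k l where "a k * b l > 0" "odd (k + l)" "k + l \<ge> m" using odd[of m] by blast
        then show ?thesis using neg_one_odd_power[of "k + l", where 'a = real] by blast
      qed
    qed
    \<comment> \<open>Adding the two limits cancels the antipodal pairs and doubles the diagonal;
      distinct points keep all other pairs away from inner product 1.\<close>
    ultimately have "0 = (\<Sum>i<N. \<Sum>j<N. c i * c j * (if x i \<bullet> x j = 1 then 1 else if x i \<bullet> x j = - 1 then 1 else 0)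
        + c i * c j * (if x i \<bullet> x j = 1 then 1 else if x i \<bullet> x j = - 1 then - 1 else 0))"
      by (simp only: sum.distrib add_0_right)
    also have "\<dots> = (\<Sum>i<N. \<Sum>j<N. if j = i then 2 * (c i)\<^sup>2 else 0)"
    proof (intro sum.cong refl)
      fix i j assume ij: "i \<in> {..<N}" "j \<in> {..<N}"
      then have "x i \<bullet> x j = 1 \<longleftrightarrow> j = i"
        using sphere_inner_eq_1_iff[of "x i" "x j"] x inj by (auto simp: inj_on_def)
      then show "c i * c j * (if x i \<bullet> x j = 1 then 1 else if x i \<bullet> x j = - 1 then 1 else 0)
        + c i * c j * (if x i \<bullet> x j = 1 then 1 else if x i \<bullet> x j = - 1 then - 1 else 0)
        = (if j = i then 2 * (c i)\<^sup>2 else 0)"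
        by (auto simp: power2_eq_square)
    qed
    also have "\<dots> = (\<Sum>i<N. 2 * (c i)\<^sup>2)" by (simp add: sum.delta)
    finally have "\<forall>i\<in>{..<N}. 2 * (c i)\<^sup>2 = 0"
      by (subst (asm) eq_commute, subst (asm) sum_nonneg_eq_0_iff) auto
    with c show False by auto
  qed
  then show ?thesis
    unfolding strictly_pos_def_kernel_on_def pos_def_kernel_on_def
    using product_form_nonneg(1)[OF assms(1)] by (simp add: kernel order_less_le del: mem_sphere_0)
qed

text \<open>The witness is a regular \<open>2 * q\<close>-gon on a great circle with alternating
  signs. Its form vanishes for each \<open>P k * P l\<close> of positive weight, hence for
  \<open>f * g\<close>.\<close>

lemma product_not_strictly_pos_def:
  assumes "DIM('a::euclidean_space) = d + 1" "q > 0"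
    and "\<And>k l. a k * b l > 0 \<Longrightarrow> k + l < q \<or> odd (k + l + q)"
  shows "\<not> strictly_pos_def_kernel_on (sphere (0 :: 'a) 1) (isotropic_kernel (\<lambda>t. f t * g t))"
proof -
  \<comment> \<open>Two orthonormal directions are needed to span the plane of the polygon.\<close>
  have "2 \<le> card (Basis :: 'a set)" using assms(1) d by simp
  then obtain B :: "'a set" where "B \<subseteq> Basis" "card B = 2"
    by (rule obtain_subset_with_card_n)
  then obtain u v :: 'a where uv: "u \<in> Basis" "v \<in> Basis" "u \<noteq> v"
    by (auto simp: card_2_iff)
  define \<theta> where "\<theta> i = pi * real i / real q" for i
  define x where "x i = cos (\<theta> i) *\<^sub>R u + sin (\<theta> i) *\<^sub>R v" for i
  define c :: "nat \<Rightarrow> real" where "c i = (- 1) ^ i" for i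
  have inner: "x i \<bullet> x j = cos (\<theta> i - pi * real j / real q)" for i j
  proof -
    have "u \<bullet> u = 1" "v \<bullet> v = 1" "u \<bullet> v = 0" "v \<bullet> u = 0"
      using uv by (simp_all add: inner_Basis)
    then have "x i \<bullet> x j = cos (\<theta> i) * cos (\<theta> j) + sin (\<theta> i) * sin (\<theta> j)"
      by (simp add: x_def inner_add_left inner_add_right)
    then show ?thesis by (simp add: cos_diff \<theta>_def)
  qed
  have sphere: "x i \<in> sphere 0 1" for i
    using inner[of i i] by (simp add: norm_eq_1 \<theta>_def)
  have inj: "inj_on x {..<2 * q}"
  proof (rule inj_onI)
    fix i j assume ij: "i \<in> {..<2 * q}" "j \<in> {..<2 * q}" "x i = x j"
    then have "x i \<bullet> x j = 1" using sphere_inner_eq_1_iff[OF sphere sphere] by simp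
    then obtain n :: int where "\<theta> i - pi * real j / real q = real_of_int n * 2 * pi"
      unfolding inner cos_one_2pi_int by blast
    then have "pi * (real i - real j) = pi * (2 * real_of_int n * real q)"
      using assms(2) by (simp add: \<theta>_def field_simps)
    then have "real i - real j = 2 * real_of_int n * real q"
      by (simp only: mult_left_cancel[OF pi_neq_zero])
    then have "real_of_int (int i - int j) = real_of_int (2 * int q * n)" by simp
    then have n: "int i - int j = 2 * int q * n" by (simp only: of_int_eq_iff)
    \<comment> \<open>Equal points have indices congruent modulo \<open>2 * q\<close>, while the
      indices differ by less than that.\<close>
    then have "2 * int q dvd int i - int j" by simp
    moreover have "\<bar>int i - int j\<bar> < 2 * int q" using ij by auto
    ultimately have "int i - int j = 0"
      using dvd_imp_le_int[of "int i - int j" "2 * int q"] by linarith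
    then show "i = j" by simp
  qed
  have "(\<Sum>i<2 * q. \<Sum>j<2 * q. c i * c j * (f (x i \<bullet> x j) * g (x i \<bullet> x j))) = 0"
  proof (rule product_form_vanishes)
    fix k l assume kl: "a k * b l > 0"
    \<comment> \<open>Each row vanishes already: for fixed \<open>i\<close> the inner products are
      cosines at equally spaced angles shifted by \<open>\<theta> i\<close>.\<close>
    have "(\<Sum>j<2 * q. c i * c j * (P k (x i \<bullet> x j) * P l (x i \<bullet> x j))) =
        c i * (\<Sum>j<2 * q. c j * (P k (x i \<bullet> x j) * P l (x i \<bullet> x j)))" for i
      by (simp only: mult.assoc sum_distrib_left)
    then have "(\<Sum>j<2 * q. c i * c j * (P k (x i \<bullet> x j) * P l (x i \<bullet> x j))) = 0" for i
      unfolding inner c_def alternating_jacobi_P_sum[OF assms(2) assms(3)[OF kl]] by simp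
    then show "(\<Sum>i<2 * q. \<Sum>j<2 * q. c i * c j * (P k (x i \<bullet> x j) * P l (x i \<bullet> x j))) = 0"
      by simp
  qed (intro sphere_inner_bounds sphere)
  moreover have "(\<Sum>i<2 * q. \<Sum>j<2 * q. c i * c j * isotropic_kernel (\<lambda>t. f t * g t) (x i) (x j)) =
      (\<Sum>i<2 * q. \<Sum>j<2 * q. c i * c j * (f (x i \<bullet> x j) * g (x i \<bullet> x j)))"
    by (simp only: isotropic_kernel_sphere[OF sphere sphere])
  moreover have c: "\<exists>i<2 * q. c i \<noteq> 0" using assms(2) by (intro exI[of _ 0]) (simp add: c_def)
  moreover have "(\<Sum>i<2 * q. \<Sum>j<2 * q. c i * c j * isotropic_kernel (\<lambda>t. f t * g t) (x i) (x j)) > 0"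
    if "strictly_pos_def_kernel_on (sphere (0 :: 'a) 1) (isotropic_kernel (\<lambda>t. f t * g t))"
  proof -
    have "\<forall>n\<ge>1. \<forall>(x :: nat \<Rightarrow> 'a) (c :: nat \<Rightarrow> real). (\<forall>i<n. x i \<in> sphere (0 :: 'a) 1) \<and> inj_on x {..<n} \<and> (\<exists>i<n. c i \<noteq> 0) \<longrightarrow>
        0 < (\<Sum>i<n. \<Sum>j<n. c i * c j * isotropic_kernel (\<lambda>t. f t * g t) (x i) (x j))"
      using that unfolding strictly_pos_def_kernel_on_def by (rule conjunct2)
    moreover have "1 \<le> 2 * q" using assms(2) by simp
    ultimately show ?thesis using sphere inj c by blast
  qed
  ultimately show ?thesis by linarith
qed

end

theorem theorem2p6:
  fixes d :: nat and f g :: "real \<Rightarrow> real" and a b :: "nat \<Rightarrow> real"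
  assumes "d \<ge> 2"
    and "CARD('n::finite) = d + 1"
    and "isotropic_part_pos_def (sphere (0 :: real ^ 'n) 1) f"
    and "isotropic_part_pos_def (sphere (0 :: real ^ 'n) 1) g"
    and "schoenberg_series d f a"
    and "schoenberg_series d g b"
  shows "isotropic_part_strictly_pos_def (sphere (0 :: real ^ 'n) 1) (\<lambda>t. f t * g t) \<longleftrightarrow>
     infinite {m \<in> {k + l | k l. a k * b l > 0}. even m} \<and>
     infinite {m \<in> {k + l | k l. a k * b l > 0}. odd m}"
proof -
  let ?J = "{k + l | k l. a k * b l > 0}"
  let ?SPD = "strictly_pos_def_kernel_on (sphere (0 :: real ^ 'n) 1) (isotropic_kernel (\<lambda>t. f t * g t))"
  have dim: "DIM(real ^ 'n) = d + 1" using assms(2) by simp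
  have cont: "continuous_on {-1..1} (\<lambda>t. f t * g t)"
    using assms(3,4) by (auto simp: isotropic_part_pos_def_def intro: continuous_on_mult)
  \<comment> \<open>The number \<open>r\<close> encodes the deficient parity: 0 for even sums, 1 for
    odd ones.\<close>
  have obstruct: "\<not> ?SPD" if fin: "finite {m \<in> ?J. even (m + r)}" for r
  proof -
    obtain M where M: "\<And>m. m \<in> {m \<in> ?J. even (m + r)} \<Longrightarrow> m \<le> M"
      using fin unfolding finite_nat_set_iff_bounded_le by blast
    show ?thesis
    \<comment> \<open>The chosen \<open>q\<close> exceeds \<open>M\<close> and has the parity of
      \<open>r\<close>: sums of that parity are below \<open>q\<close>, and for the others
      \<open>k + l + q\<close> is odd.\<close>
    proof (rule product_not_strictly_pos_def[OF assms(1,5,6) dim, of "2 * (M + 1) + r"])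
      fix k l assume "a k * b l > 0"
      then have "k + l \<le> M" if "even (k + l + r)"
        using M[of "k + l"] that by blast
      then show "k + l < 2 * (M + 1) + r \<or> odd (k + l + (2 * (M + 1) + r))"
        by (cases "even (k + l + r)") auto
    qed simp
  qed
  have "infinite {m \<in> ?J. even m} \<and> infinite {m \<in> ?J. odd m}" if ?SPD
    using obstruct[of 0] obstruct[of 1] that by auto
  moreover have ?SPD if "infinite {m \<in> ?J. even m}" "infinite {m \<in> ?J. odd m}"
  proof (rule strictly_pos_def_product[OF assms(1,5,6) dim])
    show "\<exists>k l. a k * b l > 0 \<and> even (k + l) \<and> k + l \<ge> m" for m
      using that(1) unfolding infinite_nat_iff_unbounded_le by blast
    show "\<exists>k l. a k * b l > 0 \<and> odd (k + l) \<and> k + l \<ge> m" for m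
      using that(2) unfolding infinite_nat_iff_unbounded_le by blast
  qed
  ultimately show ?thesis
    using cont by (auto simp only: isotropic_part_strictly_pos_def_def)
qed

end
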